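(* Let $H$ be a group and let $\mathcal{P} = \langle \mathbf{x}, H; R\rangle$ be a one-relator relative presentation whose $\mathbf{x}$-skeleton $W$ has the unique max-min property (that is, $\mathcal{P} \in \mathcal{M}_H$). Let $G(\mathcal{P})$ be the group defined by $\mathcal{P}$. Then: (i) the natural homomorphism $H \to G(\mathcal{P})$ is injective; (ii) $G(\mathcal{P})$ is residually finite if and only if $H$ is residually finite.
   Context: A one-relator relative presentation $\mathcal{P} = \langle \mathbf{x}, H; R\rangle$ consists of a set $\mathbf{x}$, a group $H$, and an expression $R = x_1^{\varepsilon_1} h_1 x_2^{\varepsilon_2} h_2 \cdots x_r^{\varepsilon_r} h_r$ with $r>0$, $x_i \in \mathbf{x}$, $\varepsilon_i = \pm 1$, $h_i \in H$. The word $W = x_1^{\varepsilon_1} x_2^{\varepsilon_2} \cdots x_r^{\varepsilon_r}$ is the $\mathbf{x}$-skeleton of $R$; it is not required to be reduced or cyclically reduced. The group $G(\mathcal{P})$ defined by $\mathcal{P}$ is the quotient of the free product $H * F$ ($F$ the free group on $\mathbf{x}$) by the normal closure of the element represented by $R$. The natural homomorphism $H \to G(\mathcal{P})$ is the composition of the canonical embedding $H \to H*F$ with the quotient map. A weight function on $\mathbf{x}$ is a function $\theta: \mathbf{x} \to \mathbb{Z}$ whose image generates the additive group $\mathbb{Z}$; it is strict if $\theta(x) \neq 0$ for all $x \in \mathbf{x}$. Given $W$ and $\theta$, define $\phi:\{0,1,\ldots,r\} \to \mathbb{Z}$ by $\phi(j) = \sum_{i=1}^{j} \varepsilon_i \theta(x_i)$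 (so $\phi(0)=0$). The weight function is admissible for $W$ if $\phi(r)=0$. $W$ has the unique max-min property if there are an admissible strict weight function $\theta$ and $k,l \in \{1,\ldots,r\}$ such that $\phi(j) < \phi(k)$ for all $j \in \{1,\ldots,r\}\setminus\{k\}$, $\phi(j) > \phi(l)$ for all $j \in \{1,\ldots,r\}\setminus\{l\}$, $x_k \neq x_{k+1}$ and $x_l \neq x_{l+1}$ (subscripts modulo $r$). $\mathcal{M}_H$ denotes the class of one-relator relative presentations $\langle \mathbf{x}, H; R\rangle$ whose $\mathbf{x}$-skeleton has the unique max-min property. *)

theory Defs
  imports "HOL-Algebra.Elementary_Groups"
begin

inductive_set word_cong :: "'a set \<Rightarrow> ('a list \<times> 'a list) set \<Rightarrow> ('a list \<times> 'a list) set"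
  for A :: "'a set" and S :: "('a list \<times> 'a list) set" where
  refl: "w \<in> lists A \<Longrightarrow> (w, w) \<in> word_cong A S"
| sym: "(u, v) \<in> word_cong A S \<Longrightarrow> (v, u) \<in> word_cong A S"
| trans: "(u, v) \<in> word_cong A S \<Longrightarrow> (v, w) \<in> word_cong A S \<Longrightarrow> (u, w) \<in> word_cong A S"
| step: "(u, v) \<in> S \<Longrightarrow> u \<in> lists A \<Longrightarrow> v \<in> lists A \<Longrightarrow> p \<in> lists A \<Longrightarrow> q \<in> lists A
    \<Longrightarrow> (p @ u @ q, p @ v @ q) \<in> word_cong A S"

definition presented_monoid :: "'a set \<Rightarrow> ('a list \<times> 'a list) set \<Rightarrow> 'a list set monoid" where
  "presented_monoid A S =
    \<lparr> carrier = lists A // word_cong A S,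
      monoid.mult = (\<lambda>P Q. \<Union>u\<in>P. \<Union>v\<in>Q. word_cong A S `` {u @ v}),
      one = word_cong A S `` {[]} \<rparr>"

lemma word_cong_lists: "(u, v) \<in> word_cong A S \<Longrightarrow> u \<in> lists A \<and> v \<in> lists A"
  by (induction rule: word_cong.induct) auto

lemma equiv_word_cong: "equiv (lists A) (word_cong A S)"
proof (rule equivI)
  show "word_cong A S \<subseteq> lists A \<times> lists A"
    using word_cong_lists by fast
  show "refl_on (lists A) (word_cong A S)"
    by (rule refl_onI) (rule word_cong.refl)
  show "sym (word_cong A S)"
    by (rule symI) (rule word_cong.sym)
  show "trans (word_cong A S)"
    by (rule transI) (rule word_cong.trans)
qed

lemma word_cong_context:
  assumes "(u, v) \<in> word_cong A S" "p \<in> lists A" "q \<in> lists A"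
  shows "(p @ u @ q, p @ v @ q) \<in> word_cong A S"
  using assms(1)
proof induction
  case (refl w)
  then show ?case using assms(2,3) by (intro word_cong.refl) auto
next
  case (sym u v)
  then show ?case by (blast intro: word_cong.sym)
next
  case (trans u v w)
  then show ?case by (blast intro: word_cong.trans)
next
  case (step u v p' q')
  have "((p @ p') @ u @ (q' @ q), (p @ p') @ v @ (q' @ q)) \<in> word_cong A S"
    using step assms(2,3) by (intro word_cong.step) auto
  then show ?case by simp
qed

lemma word_cong_append:
  assumes "(u, u') \<in> word_cong A S" "(v, v') \<in> word_cong A S"
  shows "(u @ v, u' @ v') \<in> word_cong A S"
proof -
  have "(u @ v, u' @ v) \<in> word_cong A S"
    using word_cong_context[OF assms(1), of "[]" v] word_cong_lists[OF assms(2)] by simp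
  moreover have "(u' @ v, u' @ v') \<in> word_cong A S"
    using word_cong_context[OF assms(2), of u' "[]"] word_cong_lists[OF assms(1)] by simp
  ultimately show ?thesis by (rule word_cong.trans)
qed

lemma word_cong_class_eq_iff:
  assumes "u \<in> lists A" "v \<in> lists A"
  shows "word_cong A S `` {u} = word_cong A S `` {v} \<longleftrightarrow> (u, v) \<in> word_cong A S"
  using eq_equiv_class_iff[OF equiv_word_cong assms] .

lemma presented_monoid_mult:
  assumes "u \<in> lists A" "v \<in> lists A"
  shows "word_cong A S `` {u} \<otimes>\<^bsub>presented_monoid A S\<^esub> word_cong A S `` {v}
    = word_cong A S `` {u @ v}"
proof -
  have "congruent2 (word_cong A S) (word_cong A S) (\<lambda>u v. word_cong A S `` {u @ v})"
    by (rule congruent2I', rule equiv_class_eq[OF equiv_word_cong], rule word_cong_append)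
  from UN_equiv_class2[OF equiv_word_cong equiv_word_cong this assms]
  show ?thesis by (simp add: presented_monoid_def)
qed

lemma presented_monoid_carrier_iff:
  "P \<in> carrier (presented_monoid A S) \<longleftrightarrow> (\<exists>w\<in>lists A. P = word_cong A S `` {w})"
  by (auto simp: presented_monoid_def quotient_def)

lemma presented_monoid_one: "\<one>\<^bsub>presented_monoid A S\<^esub> = word_cong A S `` {[]}"
  by (simp add: presented_monoid_def)

lemma group_presented_monoid:
  assumes inverses: "\<And>a. a \<in> A \<Longrightarrow> \<exists>b\<in>A. ([b, a], []) \<in> word_cong A S"
  shows "group (presented_monoid A S)"
proof (rule groupI)
  let ?G = "presented_monoid A S"
  let ?c = "\<lambda>w. word_cong A S `` {w}"
  fix P Q assume "P \<in> carrier ?G" "Q \<in> carrier ?G"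
  then obtain u v where uv: "u \<in> lists A" "v \<in> lists A" "P = ?c u" "Q = ?c v"
    unfolding presented_monoid_carrier_iff by blast
  then have "P \<otimes>\<^bsub>?G\<^esub> Q = ?c (u @ v)" "u @ v \<in> lists A"
    by (simp_all add: presented_monoid_mult)
  then show "P \<otimes>\<^bsub>?G\<^esub> Q \<in> carrier ?G"
    unfolding presented_monoid_carrier_iff by blast
  fix T assume "T \<in> carrier ?G"
  then obtain w where w: "w \<in> lists A" "T = ?c w"
    unfolding presented_monoid_carrier_iff by blast
  have "u @ v \<in> lists A" "v @ w \<in> lists A" using uv w by simp_all
  then show "P \<otimes>\<^bsub>?G\<^esub> Q \<otimes>\<^bsub>?G\<^esub> T = P \<otimes>\<^bsub>?G\<^esub> (Q \<otimes>\<^bsub>?G\<^esub> T)"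
    by (simp only: uv w presented_monoid_mult append_assoc)
next
  let ?G = "presented_monoid A S"
  show "\<one>\<^bsub>?G\<^esub> \<in> carrier ?G"
    unfolding presented_monoid_carrier_iff presented_monoid_one by (rule bexI[of _ "[]"]) simp_all
  fix P assume "P \<in> carrier ?G"
  then obtain w where w: "w \<in> lists A" "P = word_cong A S `` {w}"
    unfolding presented_monoid_carrier_iff by blast
  have nil: "[] \<in> lists A" by simp
  show "\<one>\<^bsub>?G\<^esub> \<otimes>\<^bsub>?G\<^esub> P = P"
    using presented_monoid_mult[OF nil w(1)] w(2) by (simp only: presented_monoid_one append_Nil)
  have "\<exists>w'\<in>lists A. (w' @ w, []) \<in> word_cong A S"
    using w(1)
  proof (induction w rule: lists.induct)
    case Nil
    have "([] @ [], []) \<in> word_cong A S" by (simp add: word_cong.refl)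
    then show ?case by (blast intro: lists.Nil)
  next
    case (Cons a w)
    then obtain w' where w': "w' \<in> lists A" "(w' @ w, []) \<in> word_cong A S" by blast
    obtain b where b: "b \<in> A" "([b, a], []) \<in> word_cong A S"
      using inverses Cons by blast
    have "(w' @ [b, a] @ w, w' @ [] @ w) \<in> word_cong A S"
      using b(2) w'(1) Cons.hyps(2) by (rule word_cong_context)
    then have "((w' @ [b]) @ (a # w), []) \<in> word_cong A S"
      using word_cong.trans[OF _ w'(2)] by simp
    moreover have "w' @ [b] \<in> lists A" using w'(1) b(1) by simp
    ultimately show ?case by blast
  qed
  then obtain w' where w': "w' \<in> lists A" "(w' @ w, []) \<in> word_cong A S" by blast
  then have "word_cong A S `` {w'} \<otimes>\<^bsub>?G\<^esub> P = \<one>\<^bsub>?G\<^esub>"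
    using presented_monoid_mult[OF w'(1) w(1)] equiv_class_eq[OF equiv_word_cong w'(2)] w(2)
    by (simp only: presented_monoid_one)
  moreover have "word_cong A S `` {w'} \<in> carrier ?G"
    unfolding presented_monoid_carrier_iff using w'(1) by blast
  ultimately show "\<exists>Q\<in>carrier ?G. Q \<otimes>\<^bsub>?G\<^esub> P = \<one>\<^bsub>?G\<^esub>" by blast
qed

text \<open>The letter \<open>(x, True)\<close> stands for \<open>x\<close> and \<open>(x, False)\<close> for its inverse.\<close>

definition free_group :: "'x set \<Rightarrow> ('x \<times> bool) list set monoid" where
  "free_group V = presented_monoid (V \<times> UNIV) {([(x, b), (x, \<not> b)], []) | x b. x \<in> V}"

definition free_gen :: "'x set \<Rightarrow> 'x \<Rightarrow> ('x \<times> bool) list set" where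
  "free_gen V x = word_cong (V \<times> UNIV) {([(x, b), (x, \<not> b)], []) | x b. x \<in> V} `` {[(x, True)]}"

definition free_product_rels ::
    "('a, 'm) monoid_scheme \<Rightarrow> ('b, 'n) monoid_scheme \<Rightarrow> (('a + 'b) list \<times> ('a + 'b) list) set" where
  "free_product_rels G K =
     {([Inl a, Inl b], [Inl (a \<otimes>\<^bsub>G\<^esub> b)]) | a b. a \<in> carrier G \<and> b \<in> carrier G}
   \<union> {([Inr a, Inr b], [Inr (a \<otimes>\<^bsub>K\<^esub> b)]) | a b. a \<in> carrier K \<and> b \<in> carrier K}
   \<union> {([Inl \<one>\<^bsub>G\<^esub>], []), ([Inr \<one>\<^bsub>K\<^esub>], [])}"

definition free_product ::
    "('a, 'm) monoid_scheme \<Rightarrow> ('b, 'n) monoid_scheme \<Rightarrow> ('a + 'b) list set monoid" where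
  "free_product G K = presented_monoid (Inl ` carrier G \<union> Inr ` carrier K) (free_product_rels G K)"

definition free_product_inl ::
    "('a, 'm) monoid_scheme \<Rightarrow> ('b, 'n) monoid_scheme \<Rightarrow> 'a \<Rightarrow> ('a + 'b) list set" where
  "free_product_inl G K a = word_cong (Inl ` carrier G \<union> Inr ` carrier K) (free_product_rels G K) `` {[Inl a]}"

definition free_product_inr ::
    "('a, 'm) monoid_scheme \<Rightarrow> ('b, 'n) monoid_scheme \<Rightarrow> 'b \<Rightarrow> ('a + 'b) list set" where
  "free_product_inr G K b = word_cong (Inl ` carrier G \<union> Inr ` carrier K) (free_product_rels G K) `` {[Inr b]}"

lemma group_free_group: "group (free_group V)"
  unfolding free_group_def
proof (rule group_presented_monoid)
  let ?S = "{([(x, b), (x, \<not> b)], []) | x b. x \<in> V}"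
  fix a :: "'a \<times> bool" assume a: "a \<in> V \<times> UNIV"
  then obtain x b where x: "x \<in> V" and ab: "a = (x, b)" by blast
  have "([] @ [(x, \<not> b), (x, \<not> \<not> b)] @ [], [] @ [] @ []) \<in> word_cong (V \<times> UNIV) ?S"
    by (rule word_cong.step) (use x in \<open>simp_all only: lists.intros SigmaI UNIV_I, blast\<close>)
  then have "([(x, \<not> b), a], []) \<in> word_cong (V \<times> UNIV) ?S"
    by (simp add: ab)
  moreover have "(x, \<not> b) \<in> V \<times> UNIV" using x by simp
  ultimately show "\<exists>c\<in>V \<times> UNIV. ([c, a], []) \<in> word_cong (V \<times> UNIV) ?S" by (rule bexI)
qed

lemma group_free_product:
  assumes "group G" "group K"
  shows "group (free_product G K)"
  unfolding free_product_def
proof (rule group_presented_monoid)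
  interpret G: group G by fact
  interpret K: group K by fact
  let ?A = "Inl ` carrier G \<union> Inr ` carrier K" and ?S = "free_product_rels G K"
  fix a assume "a \<in> ?A"
  then consider (l) g where "a = Inl g" "g \<in> carrier G" | (r) k where "a = Inr k" "k \<in> carrier K"
    by blast
  then show "\<exists>b\<in>?A. ([b, a], []) \<in> word_cong ?A ?S"
  proof cases
    case l
    have "([] @ [Inl (inv\<^bsub>G\<^esub> g), Inl g] @ [], [] @ [Inl (inv\<^bsub>G\<^esub> g \<otimes>\<^bsub>G\<^esub> g)] @ []) \<in> word_cong ?A ?S"
      by (rule word_cong.step) (use l(2) in \<open>auto simp: free_product_rels_def\<close>)
    then have "([Inl (inv\<^bsub>G\<^esub> g), Inl g], [Inl \<one>\<^bsub>G\<^esub>]) \<in> word_cong ?A ?S"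
      using l(2) by simp
    moreover have "([] @ [Inl \<one>\<^bsub>G\<^esub>] @ [], [] @ [] @ []) \<in> word_cong ?A ?S"
      by (rule word_cong.step) (auto simp: free_product_rels_def)
    then have "([Inl \<one>\<^bsub>G\<^esub>], []) \<in> word_cong ?A ?S"
      by simp
    ultimately have "([Inl (inv\<^bsub>G\<^esub> g), Inl g], []) \<in> word_cong ?A ?S"
      by (rule word_cong.trans)
    moreover have "Inl (inv\<^bsub>G\<^esub> g) \<in> ?A"
      using l(2) by simp
    ultimately show ?thesis
      unfolding l(1) by (rule bexI)
  next
    case r
    have "([] @ [Inr (inv\<^bsub>K\<^esub> k), Inr k] @ [], [] @ [Inr (inv\<^bsub>K\<^esub> k \<otimes>\<^bsub>K\<^esub> k)] @ []) \<in> word_cong ?A ?S"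
      by (rule word_cong.step) (use r(2) in \<open>auto simp: free_product_rels_def\<close>)
    then have "([Inr (inv\<^bsub>K\<^esub> k), Inr k], [Inr \<one>\<^bsub>K\<^esub>]) \<in> word_cong ?A ?S"
      using r(2) by simp
    moreover have "([] @ [Inr \<one>\<^bsub>K\<^esub>] @ [], [] @ [] @ []) \<in> word_cong ?A ?S"
      by (rule word_cong.step) (auto simp: free_product_rels_def)
    then have "([Inr \<one>\<^bsub>K\<^esub>], []) \<in> word_cong ?A ?S"
      by simp
    ultimately have "([Inr (inv\<^bsub>K\<^esub> k), Inr k], []) \<in> word_cong ?A ?S"
      by (rule word_cong.trans)
    moreover have "Inr (inv\<^bsub>K\<^esub> k) \<in> ?A"
      using r(2) by simp
    ultimately show ?thesis
      unfolding r(1) by (rule bexI)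
  qed
qed

definition normal_closure :: "('a, 'm) monoid_scheme \<Rightarrow> 'a set \<Rightarrow> 'a set" where
  "normal_closure G S = \<Inter>{N. N \<lhd> G \<and> S \<subseteq> N}"

definition residually_finite :: "('a, 'm) monoid_scheme \<Rightarrow> bool" where
  "residually_finite G \<longleftrightarrow>
    (\<forall>g\<in>carrier G. g \<noteq> \<one>\<^bsub>G\<^esub> \<longrightarrow> (\<exists>N. N \<lhd> G \<and> finite (rcosets\<^bsub>G\<^esub> N) \<and> g \<notin> N))"

text \<open>The expression \<open>R\<close> with syllables \<open>x\<^sub>i\<close> (to the power \<open>\<epsilon>\<^sub>i\<close>) followed by \<open>h\<^sub>i\<close> is encoded
  as the list of the triples \<open>(x\<^sub>i, \<epsilon>\<^sub>i, h\<^sub>i)\<close>.\<close>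

type_synonym ('x, 'h) rel_expr = "('x \<times> int \<times> 'h) list"

definition relative_presentation ::
    "'x set \<Rightarrow> ('h, 'm) monoid_scheme \<Rightarrow> ('x, 'h) rel_expr \<Rightarrow> bool" where
  "relative_presentation V H R \<longleftrightarrow>
    group H \<and> R \<noteq> [] \<and> (\<forall>(x, \<epsilon>, h)\<in>set R. x \<in> V \<and> \<epsilon> \<in> {1, -1} \<and> h \<in> carrier H)"

abbreviation rel_free_product ::
    "'x set \<Rightarrow> ('h, 'm) monoid_scheme \<Rightarrow> ('h + ('x \<times> bool) list set) list set monoid" where
  "rel_free_product V H \<equiv> free_product H (free_group V)"

fun relator ::
    "'x set \<Rightarrow> ('h, 'm) monoid_scheme \<Rightarrow> ('x, 'h) rel_expr
      \<Rightarrow> ('h + ('x \<times> bool) list set) list set" where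
  "relator V H [] = \<one>\<^bsub>rel_free_product V H\<^esub>"
| "relator V H ((x, \<epsilon>, h) # R) =
     free_product_inr H (free_group V) (free_gen V x [^]\<^bsub>free_group V\<^esub> \<epsilon>)
     \<otimes>\<^bsub>rel_free_product V H\<^esub> (free_product_inl H (free_group V) h
     \<otimes>\<^bsub>rel_free_product V H\<^esub> relator V H R)"

definition rel_group ::
    "'x set \<Rightarrow> ('h, 'm) monoid_scheme \<Rightarrow> ('x, 'h) rel_expr
      \<Rightarrow> ('h + ('x \<times> bool) list set) list set set monoid" where
  "rel_group V H R =
    rel_free_product V H Mod normal_closure (rel_free_product V H) {relator V H R}"

definition natural_hom ::
    "'x set \<Rightarrow> ('h, 'm) monoid_scheme \<Rightarrow> ('x, 'h) rel_expr
      \<Rightarrow> 'h \<Rightarrow> ('h + ('x \<times> bool) list set) list set set" where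
  "natural_hom V H R h =
    normal_closure (rel_free_product V H) {relator V H R}
      #>\<^bsub>rel_free_product V H\<^esub> free_product_inl H (free_group V) h"

definition skeleton :: "('x, 'h) rel_expr \<Rightarrow> ('x \<times> int) list" where
  "skeleton R = map (\<lambda>(x, \<epsilon>, h). (x, \<epsilon>)) R"

definition weight_function :: "'x set \<Rightarrow> ('x \<Rightarrow> int) \<Rightarrow> bool" where
  "weight_function V \<theta> \<longleftrightarrow> generate integer_group (\<theta> ` V) = carrier integer_group"

definition strict_weight_function :: "'x set \<Rightarrow> ('x \<Rightarrow> int) \<Rightarrow> bool" where
  "strict_weight_function V \<theta> \<longleftrightarrow> weight_function V \<theta> \<and> (\<forall>x\<in>V. \<theta> x \<noteq> 0)"

text \<open>Lists are indexed from 0, so the \<open>i\<close>-th letter of a word \<open>W\<close> of length \<open>r\<close> is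
  \<open>W ! (i - 1)\<close>, and its cyclic successor is \<open>W ! (i mod r)\<close>, for \<open>i \<in> {1..r}\<close>.\<close>

definition height :: "('x \<Rightarrow> int) \<Rightarrow> ('x \<times> int) list \<Rightarrow> nat \<Rightarrow> int" where
  "height \<theta> W j = (\<Sum>i = 1..j. snd (W ! (i - 1)) * \<theta> (fst (W ! (i - 1))))"

definition admissible :: "('x \<Rightarrow> int) \<Rightarrow> ('x \<times> int) list \<Rightarrow> bool" where
  "admissible \<theta> W \<longleftrightarrow> height \<theta> W (length W) = 0"

definition unique_max_min :: "'x set \<Rightarrow> ('x \<times> int) list \<Rightarrow> bool" where
  "unique_max_min V W \<longleftrightarrow>
    (\<exists>\<theta>. strict_weight_function V \<theta> \<and> admissible \<theta> W \<and>
      (\<exists>k\<in>{1..length W}. \<exists>l\<in>{1..length W}.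
        (\<forall>j\<in>{1..length W} - {k}. height \<theta> W j < height \<theta> W k) \<and>
        (\<forall>j\<in>{1..length W} - {l}. height \<theta> W j > height \<theta> W l) \<and>
        fst (W ! (k - 1)) \<noteq> fst (W ! (k mod length W)) \<and>
        fst (W ! (l - 1)) \<noteq> fst (W ! (l mod length W))))"

end

theory Submission
  imports Defs "HOL-Combinatorics.Permutations"
begin

text \<open>The weight \<open>\<theta>\<close> unfolds the relator into translates \<open>R\<^sub>n\<close> of one word, whose letters are the edges
  \<open>n \<rightarrow> n + \<theta> x\<close> of a graph on the integers. By the unique maximum (minimum), \<open>R\<^sub>n\<close> contains some edge
  through its highest (lowest) vertex exactly once and can be solved for it. A labelling of the edges in a
  bounded window by elements of a group \<open>P\<close> that satisfies the relators inside the window thus has as many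
  one-step extensions upwards as downwards, and shifting the window becomes a bijection of the set of
  labellings. Its orbits label the whole graph, periodically with some period \<open>N > 0\<close> if \<open>P\<close> is finite, and
  a labelling of period \<open>N\<close> gives a homomorphism from the presented group to a wreath product of \<open>P\<close>.

  With \<open>P = H\<close> this shows that \<open>H\<close> embeds. For residual finiteness, a nontrivial element of weight \<open>0\<close> is a
  word in the edges of a window; solving the relators of the window for their top edges turns it into a word
  in \<open>H\<close> and free letters, which is detected in a finite group \<open>P\<close> because \<open>H\<close> is residually finite.\<close>

section \<open>Words over a group and solvable relators\<close>

text \<open>Uniqueness of the extreme heights alone is not enough: the letters before and after the
  maximum could run up and down the same edge. The condition on cyclic successors excludes this, so
  that the relator can be solved for that edge. A step upwards meets one new edge per generator but
  only one new relator, so all other new labels are free, and arbitrary choices would give no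
  period. The step also drops one edge per generator and one relator that determines one of the
  dropped labels. Feeding the remaining dropped labels back in as the free new ones makes the step a
  reversible map. Reversibility matters: iterating a mere self-map of a finite set is only
  eventually periodic, and the labelling that detects the given element might never recur. The
  maximum yields the successor, the minimum the predecessor. The set of generators may be infinite,
  while a period needs finitely many states. Windows therefore use only the generators in the
  relator and, for residual finiteness, in the given element; all others are labelled by 1.\<close>

fun letter_value ::
    "('p, 'n) monoid_scheme \<Rightarrow> ('h \<Rightarrow> 'p) \<Rightarrow> ('e \<Rightarrow> 'p) \<Rightarrow> 'h + 'e \<times> bool \<Rightarrow> 'p" where
  "letter_value P \<rho> p (Inl h) = \<rho> h"
| "letter_value P \<rho> p (Inr (e, b)) = (if b then p e else inv\<^bsub>P\<^esub> p e)"

text \<open>\<open>Inr (e, True)\<close> is the letter \<open>e\<close> and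
  \<open>Inr (e, False)\<close> its inverse. Words stay plain lists, never quotiented, because
  single occurrences of letters matter; \<open>'e\<close> is a type of generators or of
  edges.\<close>

fun word_value ::
    "('p, 'n) monoid_scheme \<Rightarrow> ('h \<Rightarrow> 'p) \<Rightarrow> ('e \<Rightarrow> 'p) \<Rightarrow> ('h + 'e \<times> bool) list \<Rightarrow> 'p" where
  "word_value P \<rho> p [] = \<one>\<^bsub>P\<^esub>"
| "word_value P \<rho> p (a # w) = letter_value P \<rho> p a \<otimes>\<^bsub>P\<^esub> word_value P \<rho> p w"

definition coeffs :: "('h + 'e \<times> bool) list \<Rightarrow> 'h set" where
  "coeffs w = {h. Inl h \<in> set w}"

definition edges :: "('h + 'e \<times> bool) list \<Rightarrow> 'e set" where
  "edges w = {e. \<exists>b. Inr (e, b) \<in> set w}"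

lemma coeffs_simps [simp]:
  "coeffs [] = {}" "coeffs (Inl h # w) = insert h (coeffs w)" "coeffs (Inr eb # w) = coeffs w"
  "coeffs (u @ w) = coeffs u \<union> coeffs w"
  by (auto simp: coeffs_def)

lemma edges_simps [simp]:
  "edges [] = {}" "edges (Inl h # w) = edges w" "edges (Inr (e, b) # w) = insert e (edges w)"
  "edges (u @ w) = edges u \<union> edges w"
  by (auto simp: edges_def)

lemma word_induct [case_names Nil Inl Inr]:
  fixes w :: "('h + 'e \<times> bool) list"
  assumes "Q []" "\<And>h w. Q w \<Longrightarrow> Q (Inl h # w)" "\<And>e b w. Q w \<Longrightarrow> Q (Inr (e, b) # w)"
  shows "Q w"
proof (induction w)
  case (Cons a w)
  then show ?case using assms(2,3) by (cases a) auto
qed (rule assms(1))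

lemma finite_edges: "finite (edges w)"
  by (induction w rule: word_induct) auto

definition interp ::
    "('h, 'm) monoid_scheme \<Rightarrow> ('p, 'n) monoid_scheme \<Rightarrow> ('h \<Rightarrow> 'p) \<Rightarrow> ('e \<Rightarrow> 'p) \<Rightarrow> bool" where
  "interp H P \<rho> p \<longleftrightarrow> group H \<and> group P \<and> \<rho> \<in> hom H P \<and> range p \<subseteq> carrier P"

lemma interpD:
  assumes "interp H P \<rho> p"
  shows "group H" "group P" "\<rho> \<in> hom H P" "p e \<in> carrier P"
    "h \<in> carrier H \<Longrightarrow> \<rho> h \<in> carrier P"
  using assms unfolding interp_def hom_def by auto

lemma interp_upd: "interp H P \<rho> p \<Longrightarrow> v \<in> carrier P \<Longrightarrow> interp H P \<rho> (p(e := v))"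
  unfolding interp_def by auto

lemma word_value_closed:
  assumes "interp H P \<rho> p" "coeffs w \<subseteq> carrier H"
  shows "word_value P \<rho> p w \<in> carrier P"
proof -
  interpret P: group P using assms(1) by (rule interpD)
  show ?thesis
    using assms(2) by (induction w rule: word_induct) (auto simp: interpD[OF assms(1)])
qed

lemma word_value_append:
  assumes "interp H P \<rho> p" "coeffs u \<subseteq> carrier H" "coeffs w \<subseteq> carrier H"
  shows "word_value P \<rho> p (u @ w) = word_value P \<rho> p u \<otimes>\<^bsub>P\<^esub> word_value P \<rho> p w"
proof -
  interpret P: group P using assms(1) by (rule interpD)
  show ?thesis
    using assms(2)
    by (induction u rule: word_induct)
      (auto simp: interpD[OF assms(1)] word_value_closed[OF assms(1)] assms(3) P.m_assoc)
qed

lemma word_value_cong: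
  assumes "\<And>e. e \<in> edges w \<Longrightarrow> p e = p' e" "\<And>h. h \<in> coeffs w \<Longrightarrow> \<rho> h = \<rho>' h"
  shows "word_value P \<rho> p w = word_value P \<rho>' p' w"
  using assms by (induction w rule: word_induct) auto

lemma word_value_upd: "e \<notin> edges w \<Longrightarrow> word_value P \<rho> (p(e := v)) w = word_value P \<rho> p w"
  by (rule word_value_cong) auto

lemma word_value_hom:
  assumes "interp H P \<rho> p" "coeffs w \<subseteq> carrier H" "group Q" "\<Phi> \<in> hom P Q"
  shows "\<Phi> (word_value P \<rho> p w) = word_value Q (\<lambda>h. \<Phi> (\<rho> h)) (\<lambda>e. \<Phi> (p e)) w"
proof -
  interpret \<Phi>: group_hom P Q \<Phi>
    using assms interpD(2)[OF assms(1)] by (simp add: group_hom_def group_hom_axioms_def)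
  show ?thesis
    using assms(2)
    by (induction w rule: word_induct)
      (auto simp: interpD[OF assms(1)] word_value_closed[OF assms(1)])
qed

abbreviation map_edges :: "('e \<Rightarrow> 'f) \<Rightarrow> ('h + 'e \<times> bool) list \<Rightarrow> ('h + 'f \<times> bool) list" where
  "map_edges g \<equiv> map (map_sum id (map_prod g id))"

lemma word_value_map_edges: "word_value P \<rho> p (map_edges g w) = word_value P \<rho> (\<lambda>e. p (g e)) w"
  by (induction w rule: word_induct) auto

lemma coeffs_map_edges [simp]: "coeffs (map_edges g w) = coeffs w"
  by (induction w rule: word_induct) (auto simp: id_def)

lemma edges_map_edges [simp]: "edges (map_edges g w) = g ` edges w"
  by (induction w rule: word_induct) (auto simp: id_def)

section \<open>Formal inversion and substitution of words\<close>

fun word_inverse :: "('h, 'm) monoid_scheme \<Rightarrow> ('h + 'e \<times> bool) list \<Rightarrow> ('h + 'e \<times> bool) list" where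
  "word_inverse H [] = []"
| "word_inverse H (Inl h # w) = word_inverse H w @ [Inl (inv\<^bsub>H\<^esub> h)]"
| "word_inverse H (Inr (e, b) # w) = word_inverse H w @ [Inr (e, \<not> b)]"

lemma coeffs_word_inverse:
  assumes "group H" "coeffs w \<subseteq> carrier H"
  shows "coeffs (word_inverse H w) \<subseteq> carrier H"
  using assms(2) by (induction w rule: word_induct) (auto simp: group.inv_closed[OF assms(1)])

lemma edges_word_inverse [simp]: "edges (word_inverse H w) = edges w"
  by (induction w rule: word_induct) auto

lemma word_value_inverse:
  assumes "interp H P \<rho> p" "coeffs w \<subseteq> carrier H"
  shows "word_value P \<rho> p (word_inverse H w) = inv\<^bsub>P\<^esub> word_value P \<rho> p w"
proof -
  interpret \<rho>: group_hom H P \<rho>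
    using interpD[OF assms(1)] by (simp add: group_hom_def group_hom_axioms_def)
  show ?thesis
    using assms(2)
    by (induction w rule: word_induct)
      (auto simp: interpD[OF assms(1)] word_value_closed[OF assms(1)] word_value_append[OF assms(1)]
        coeffs_word_inverse[OF interpD(1)[OF assms(1)]]
        \<rho>.inv_mult_group)
qed

fun word_subst ::
    "'e \<Rightarrow> ('h, 'm) monoid_scheme \<Rightarrow> ('h + 'e \<times> bool) list \<Rightarrow> ('h + 'e \<times> bool) list
      \<Rightarrow> ('h + 'e \<times> bool) list" where
  "word_subst e H s [] = []"
| "word_subst e H s (Inl h # w) = Inl h # word_subst e H s w"
| "word_subst e H s (Inr (f, b) # w) =
     (if f = e then if b then s else word_inverse H s else [Inr (f, b)]) @ word_subst e H s w"

lemma coeffs_word_subst: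
  assumes "group H" "coeffs s \<subseteq> carrier H" "coeffs w \<subseteq> carrier H"
  shows "coeffs (word_subst e H s w) \<subseteq> carrier H"
  using assms(3) by (induction w rule: word_induct) (use assms(2) coeffs_word_inverse[OF assms(1,2)] in auto)

text \<open>Elimination of a generator: a relator solved for \<open>e\<close> can be forgotten and
  later restored by labelling \<open>e\<close> with the value of \<open>s\<close>.\<close>

lemma word_value_subst:
  assumes "interp H P \<rho> p" "coeffs s \<subseteq> carrier H" "coeffs w \<subseteq> carrier H"
  shows "word_value P \<rho> p (word_subst e H s w) = word_value P \<rho> (p(e := word_value P \<rho> p s)) w"
  using assms(3)
proof (induction w rule: word_induct)
  case (Inr f b w)
  note H = interpD(1)[OF assms(1)]
  interpret P: group P using assms(1) by (rule interpD)
  have "word_value P \<rho> p (word_subst e H s (Inr (f, b) # w)) =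
    word_value P \<rho> p (if f = e then if b then s else word_inverse H s else [Inr (f, b)])
      \<otimes>\<^bsub>P\<^esub> word_value P \<rho> p (word_subst e H s w)"
    unfolding word_subst.simps
    using Inr.prems assms(2) coeffs_word_inverse[OF H assms(2)] coeffs_word_subst[OF H assms(2)]
    by (intro word_value_append[OF assms(1)]) auto
  also have "\<dots> = word_value P \<rho> (p(e := word_value P \<rho> p s)) (Inr (f, b) # w)"
    using Inr word_value_inverse[OF assms(1,2)] interpD(4)[OF assms(1)] by (simp add: fun_upd_def)
  finally show ?case .
qed auto

text \<open>The value that the letter \<open>e\<close> must take for \<open>u @ Inr (e, b) # v\<close> to be trivial.\<close>

definition solution ::
    "('h, 'm) monoid_scheme \<Rightarrow> ('h + 'e \<times> bool) list \<Rightarrow> bool \<Rightarrow> ('h + 'e \<times> bool) list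
      \<Rightarrow> ('h + 'e \<times> bool) list" where
  "solution H u b v = (if b then word_inverse H (v @ u) else v @ u)"

lemma coeffs_solution:
  assumes "group H" "coeffs u \<subseteq> carrier H" "coeffs v \<subseteq> carrier H"
  shows "coeffs (solution H u b v) \<subseteq> carrier H"
  using assms coeffs_word_inverse[of H "v @ u"] by (auto simp: solution_def)

lemma edges_solution: "edges (solution H u b v) = edges u \<union> edges v"
  by (auto simp: solution_def)

text \<open>Conjugation moves \<open>u\<close> behind \<open>v\<close>, so the word is trivial iff
  the signed letter is inverse to \<open>v @ u\<close>. Both sides are evaluated at the same
  \<open>p\<close>, hence \<open>e\<close> may here still occur in \<open>u\<close> and
  \<open>v\<close>.\<close>

lemma word_value_solution_iff:
  assumes "interp H P \<rho> p" "coeffs u \<subseteq> carrier H" "coeffs v \<subseteq> carrier H"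
  shows "word_value P \<rho> p (u @ Inr (e, b) # v) = \<one>\<^bsub>P\<^esub> \<longleftrightarrow> p e = word_value P \<rho> p (solution H u b v)"
proof -
  interpret P: group P using assms(1) by (rule interpD)
  define a c x where "a = word_value P \<rho> p u" and "c = word_value P \<rho> p v" and "x = p e"
  have cl: "a \<in> carrier P" "c \<in> carrier P" "x \<in> carrier P"
    using assms by (simp_all add: a_def c_def x_def word_value_closed[OF assms(1)] interpD)
  have "word_value P \<rho> p (u @ Inr (e, b) # v) = a \<otimes>\<^bsub>P\<^esub> ((if b then x else inv\<^bsub>P\<^esub> x) \<otimes>\<^bsub>P\<^esub> c)"
    using assms(2,3) by (simp add: word_value_append[OF assms(1)] a_def c_def x_def)
  moreover have "a \<otimes>\<^bsub>P\<^esub> (y \<otimes>\<^bsub>P\<^esub> c) = \<one>\<^bsub>P\<^esub> \<longleftrightarrow> y = inv\<^bsub>P\<^esub> (c \<otimes>\<^bsub>P\<^esub> a)" if "y \<in> carrier P" for y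
  proof
    assume "a \<otimes>\<^bsub>P\<^esub> (y \<otimes>\<^bsub>P\<^esub> c) = \<one>\<^bsub>P\<^esub>"
    then have "y \<otimes>\<^bsub>P\<^esub> c = inv\<^bsub>P\<^esub> a" using cl that by (metis P.inv_equality P.inv_inv P.m_closed)
    then have "y = inv\<^bsub>P\<^esub> a \<otimes>\<^bsub>P\<^esub> inv\<^bsub>P\<^esub> c" using cl that by (metis P.inv_closed P.inv_solve_right)
    then show "y = inv\<^bsub>P\<^esub> (c \<otimes>\<^bsub>P\<^esub> a)" using cl by (simp add: P.inv_mult_group)
  next
    assume "y = inv\<^bsub>P\<^esub> (c \<otimes>\<^bsub>P\<^esub> a)"
    then show "a \<otimes>\<^bsub>P\<^esub> (y \<otimes>\<^bsub>P\<^esub> c) = \<one>\<^bsub>P\<^esub>" using cl by (simp add: P.inv_mult_group P.m_assoc)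
  qed
  moreover have "inv\<^bsub>P\<^esub> x = inv\<^bsub>P\<^esub> (c \<otimes>\<^bsub>P\<^esub> a) \<longleftrightarrow> x = c \<otimes>\<^bsub>P\<^esub> a"
    using cl P.inv_inj by (auto dest: inj_onD)
  moreover have "word_value P \<rho> p (solution H u b v) =
      (if b then inv\<^bsub>P\<^esub> (c \<otimes>\<^bsub>P\<^esub> a) else c \<otimes>\<^bsub>P\<^esub> a)"
    using assms(2,3) word_value_inverse[OF assms(1), of "v @ u"]
    by (simp add: solution_def word_value_append[OF assms(1)] a_def c_def)
  ultimately show ?thesis
    using cl by (cases b) (simp_all add: x_def[symmetric])
qed

definition occurs_once :: "'e \<Rightarrow> ('h + 'e \<times> bool) list \<Rightarrow> bool" where
  "occurs_once e w \<longleftrightarrow> (\<exists>u b v. w = u @ Inr (e, b) # v \<and> e \<notin> edges u \<and> e \<notin> edges v)"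

text \<open>The \<open>solution\<close> word omits \<open>e\<close>, so relabelling \<open>e\<close>
  does not change its value, and precisely this value solves the equation.\<close>

lemma occurs_once_solvable:
  assumes "interp H P \<rho> p" "occurs_once e w" "coeffs w \<subseteq> carrier H"
  shows "\<exists>!v. v \<in> carrier P \<and> word_value P \<rho> (p(e := v)) w = \<one>\<^bsub>P\<^esub>"
proof -
  from assms(2) obtain u b v where w: "w = u @ Inr (e, b) # v" "e \<notin> edges u" "e \<notin> edges v"
    unfolding occurs_once_def by blast
  have c: "coeffs u \<subseteq> carrier H" "coeffs v \<subseteq> carrier H" using assms(3) w by auto
  let ?s = "solution H u b v"
  have "e \<notin> edges ?s" using w(2,3) by (simp add: edges_solution)
  then have "word_value P \<rho> (p(e := x)) w = \<one>\<^bsub>P\<^esub> \<longleftrightarrow> x = word_value P \<rho> p ?s"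
    if "x \<in> carrier P" for x
    using word_value_solution_iff[OF interp_upd[OF assms(1) that] c] by (simp add: w(1) word_value_upd)
  moreover have "word_value P \<rho> p ?s \<in> carrier P"
    using coeffs_solution[OF interpD(1)[OF assms(1)] c] by (rule word_value_closed[OF assms(1)])
  ultimately show ?thesis by auto
qed

lemma occurs_once_map_edges:
  assumes "inj g" "occurs_once e w"
  shows "occurs_once (g e) (map_edges g w)"
proof -
  from assms(2) obtain u b v where w: "w = u @ Inr (e, b) # v" "e \<notin> edges u" "e \<notin> edges v"
    unfolding occurs_once_def by blast
  have "map_edges g w = map_edges g u @ Inr (g e, b) # map_edges g v" using w by simp
  moreover have "g e \<notin> edges (map_edges g u)" "g e \<notin> edges (map_edges g v)"
    using w(2,3) by (simp_all add: inj_image_mem_iff[OF assms(1)])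
  ultimately show ?thesis unfolding occurs_once_def by blast
qed

section \<open>Detecting words in finite groups\<close>

definition perm_group :: "'a set \<Rightarrow> ('a \<Rightarrow> 'a) monoid" where
  "perm_group X = \<lparr>carrier = {f. f permutes X}, monoid.mult = (\<circ>), one = id\<rparr>"

lemma perm_group_simps [simp]:
  "carrier (perm_group X) = {f. f permutes X}"
  "f \<otimes>\<^bsub>perm_group X\<^esub> g = f \<circ> g"
  "\<one>\<^bsub>perm_group X\<^esub> = id"
  by (simp_all add: perm_group_def)

lemma group_perm_group: "group (perm_group X)"
proof (rule groupI)
  fix f assume "f \<in> carrier (perm_group X)"
  then show "\<exists>g\<in>carrier (perm_group X). g \<otimes>\<^bsub>perm_group X\<^esub> f = \<one>\<^bsub>perm_group X\<^esub>"
    by (intro bexI[of _ "inv_into UNIV f"]) (auto simp: permutes_inv permutes_inv_o)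
qed (auto simp: permutes_compose o_assoc)

lemma finite_perm_group: "finite X \<Longrightarrow> finite (carrier (perm_group X))"
  by (simp add: finite_permutations)

text \<open>Domain and range of \<open>r\<close> have equal size, so their complements in the finite
  set \<open>X\<close> do too; any bijection between the complements completes
  \<open>r\<close>.\<close>

lemma partial_injection_extends:
  assumes "finite X" "r \<subseteq> X \<times> X" "single_valued r" "single_valued (r\<inverse>)"
  obtains f where "f permutes X" "\<And>a b. (a, b) \<in> r \<Longrightarrow> f a = b"
proof -
  define g where "g a = (THE b. (a, b) \<in> r)" for a
  have g: "g a = b" if "(a, b) \<in> r" for a b
    unfolding g_def using that assms(3) by (auto dest: single_valuedD)
  have bg: "bij_betw g (Domain r) (Range r)"
    unfolding bij_betw_def inj_on_def using assms(4) g by (force dest: single_valuedD)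
  have sub: "Domain r \<subseteq> X" "Range r \<subseteq> X" using assms(2) by auto
  have "card (X - Domain r) = card (X - Range r)"
    using bij_betw_same_card[OF bg] sub assms(1) by (simp add: card_Diff_subset finite_subset)
  then obtain h where bh: "bij_betw h (X - Domain r) (X - Range r)"
    using assms(1) finite_same_card_bij by (metis finite_Diff)
  define f where "f x = (if x \<in> Domain r then g x else if x \<in> X then h x else x)" for x
  have "bij_betw f (Domain r) (Range r)"
    using bg by (rule bij_betw_cong[THEN iffD1, rotated]) (simp add: f_def)
  moreover have "bij_betw f (X - Domain r) (X - Range r)"
    using bh by (rule bij_betw_cong[THEN iffD1, rotated]) (simp add: f_def)
  ultimately have "bij_betw f (Domain r \<union> (X - Domain r)) (Range r \<union> (X - Range r))"
    by (rule bij_betw_combine) auto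
  then have "bij_betw f X X" using sub by (simp add: Un_absorb1)
  then have "f permutes X"
    by (rule bij_imp_permutes) (use sub in \<open>auto simp: f_def\<close>)
  moreover have "f a = b" if "(a, b) \<in> r" for a b
    using that g by (auto simp: f_def)
  ultimately show thesis by (rule that)
qed

text \<open>One-step reductions in the free product of \<open>H\<close> and a free group. Each
  shortens the word, so every word leads to one that admits none; \<open>cancel\<close> with
  arbitrary \<open>b\<close> covers both orders of a letter and its inverse.\<close>

inductive contracts :: "('h, 'm) monoid_scheme \<Rightarrow> ('h + 'e \<times> bool) list \<Rightarrow> ('h + 'e \<times> bool) list \<Rightarrow> bool"
  for H where
  merge: "contracts H (u @ Inl a # Inl b # v) (u @ Inl (a \<otimes>\<^bsub>H\<^esub> b) # v)"
| unit: "contracts H (u @ Inl \<one>\<^bsub>H\<^esub> # v) (u @ v)"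
| cancel: "contracts H (u @ Inr (e, b) # Inr (e, \<not> b) # v) (u @ v)"

lemma contracts_length: "contracts H w w' \<Longrightarrow> length w' < length w"
  by (induction rule: contracts.induct) auto

lemma contracts_coeffs:
  "contracts H w w' \<Longrightarrow> group H \<Longrightarrow> coeffs w \<subseteq> carrier H \<Longrightarrow> coeffs w' \<subseteq> carrier H"
  by (induction rule: contracts.induct) (auto simp: group.is_monoid monoid.m_closed)

lemma word_value_contracts:
  assumes "contracts H w w'" "interp H P \<rho> p" "coeffs w \<subseteq> carrier H"
  shows "word_value P \<rho> p w = word_value P \<rho> p w'"
proof -
  note i = interpD[OF assms(2)] and wc = word_value_closed[OF assms(2)]
  interpret \<rho>: group_hom H P \<rho>
    using i by (simp add: group_hom_def group_hom_axioms_def)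
  show ?thesis
    using assms(1,3)
  proof induction
    case (cancel u e b v)
    have "p e \<otimes>\<^bsub>P\<^esub> (inv\<^bsub>P\<^esub> p e \<otimes>\<^bsub>P\<^esub> x) = x" "inv\<^bsub>P\<^esub> p e \<otimes>\<^bsub>P\<^esub> (p e \<otimes>\<^bsub>P\<^esub> x) = x" if "x \<in> carrier P" for x
      using i(4)[of e] that by (simp_all flip: \<rho>.H.m_assoc)
    then show ?case
      using cancel wc[of v] by (auto simp: word_value_append[OF assms(2)])
  qed (auto simp: word_value_append[OF assms(2)] i wc \<rho>.H.m_assoc)
qed

text \<open>A reduced word of length \<open>m\<close> acts on \<open>X = {(c, C). c \<le> m \<and> C \<in> rcosets (N c)}\<close>: the group
  \<open>H\<close> acts on the cosets, and the letters from \<open>'e\<close> move along the path \<open>pt m, \<dots>, pt 0\<close>. Reducedness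
  makes the points of the path distinct and the moves partial injections.\<close>

lemma reduced_word_detected:
  fixes H :: "('h, 'm) monoid_scheme" and w :: "('h + 'e \<times> bool) list"
  assumes "group H" "residually_finite H" "coeffs w \<subseteq> carrier H" "w \<noteq> []"
    and reduced: "\<And>w'. \<not> contracts H w w'"
  shows "\<exists>(P :: (nat \<times> 'h set \<Rightarrow> nat \<times> 'h set) monoid) \<rho> p.
    interp H P \<rho> p \<and> finite (carrier P) \<and> word_value P \<rho> p w \<noteq> \<one>\<^bsub>P\<^esub>"
proof -
  interpret H: group H by fact
  define m where "m = length w"
  have split2: "w = take i w @ w ! i # w ! Suc i # drop (Suc (Suc i)) w" if "Suc i < m" for i
    using that by (simp add: m_def Cons_nth_drop_Suc id_take_nth_drop[symmetric])
  have no_merge: "\<not> (isl (w ! i) \<and> isl (w ! Suc i))" if "Suc i < m" for i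
  proof
    assume "isl (w ! i) \<and> isl (w ! Suc i)"
    then have "w = take i w @ Inl (projl (w ! i)) # Inl (projl (w ! Suc i)) # drop (Suc (Suc i)) w"
      using split2[OF that] by simp
    then show False using reduced contracts.merge by metis
  qed
  have no_cancel: "\<not> (w ! i = Inr (e, b) \<and> w ! Suc i = Inr (e, \<not> b))" if "Suc i < m" for i e b
  proof
    assume "w ! i = Inr (e, b) \<and> w ! Suc i = Inr (e, \<not> b)"
    then have "w = take i w @ Inr (e, b) # Inr (e, \<not> b) # drop (Suc (Suc i)) w"
      using split2[OF that] by simp
    then show False using reduced contracts.cancel by metis
  qed
  have no_unit: "h \<noteq> \<one>\<^bsub>H\<^esub>" if "i < m" "w ! i = Inl h" for i h
  proof
    assume "h = \<one>\<^bsub>H\<^esub>"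
    then have "w = take i w @ Inl \<one>\<^bsub>H\<^esub> # drop (Suc i) w"
      using that id_take_nth_drop[of i w] by (simp add: m_def)
    then show False using reduced contracts.unit by metis
  qed
  have coeff: "h \<in> carrier H" if "i < m" "w ! i = Inl h" for i h
    using assms(3) nth_mem[of i w] that by (auto simp: coeffs_def m_def)
  \<comment> \<open>Level \<open>c\<close> serves the letter with index \<open>c - 1\<close>: if
    that is a coefficient \<open>h\<close>, residual finiteness gives \<open>N c\<close> avoiding
    \<open>h\<close>; otherwise \<open>carrier H\<close>, with its single coset, is the
    default.\<close>
  have "\<exists>N. N \<lhd> H \<and> finite (rcosets\<^bsub>H\<^esub> N) \<and> (\<forall>i h. c = Suc i \<and> i < m \<and> w ! i = Inl h \<longrightarrow> h \<notin> N)" for c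
  proof (cases "\<exists>i h. c = Suc i \<and> i < m \<and> w ! i = Inl h")
    case True
    then obtain i h where ih: "c = Suc i" "i < m" "w ! i = Inl h" by blast
    then obtain N where "N \<lhd> H" "finite (rcosets\<^bsub>H\<^esub> N)" "h \<notin> N"
      using assms(2) no_unit coeff unfolding residually_finite_def by blast
    then show ?thesis using ih by (intro exI[of _ N]) auto
  next
    case False
    have "finite (rcosets\<^bsub>H\<^esub> (carrier H))"
      by (rule finite_subset[of _ "{carrier H}"])
        (auto simp: RCOSETS_def H.coset_join2 H.subgroup_self)
    then show ?thesis using False H.normal_invI[OF H.subgroup_self] by auto
  qed
  then obtain N where "\<forall>c. N c \<lhd> H \<and> finite (rcosets\<^bsub>H\<^esub> (N c))
    \<and> (\<forall>i h. c = Suc i \<and> i < m \<and> w ! i = Inl h \<longrightarrow> h \<notin> N c)"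
    by (rule choice[OF allI, THEN exE])
  then have N: "\<And>c. N c \<lhd> H" "\<And>c. finite (rcosets\<^bsub>H\<^esub> (N c))"
    "\<And>i h. i < m \<Longrightarrow> w ! i = Inl h \<Longrightarrow> h \<notin> N (Suc i)"
    by blast+
  have subN: "subgroup (N c) H" for c using N(1) by (rule normal_imp_subgroup)
  interpret Q: group "H Mod N c" for c using N(1) by (rule normal.factorgroup_is_group)
  define X where "X = Sigma {0..m} (\<lambda>c. rcosets\<^bsub>H\<^esub> (N c))"
  have "finite X" unfolding X_def using N(2) by blast
  define P where "P = perm_group X"
  interpret P: group P unfolding P_def by (rule group_perm_group)
  \<comment> \<open>Left multiplication in \<open>H Mod N c\<close>, level by level; fixing
    everything outside \<open>X\<close> makes it a permutation in the sense of
    \<open>permutes\<close>.\<close>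
  define act where "act h = (\<lambda>(c, C). if (c, C) \<in> X then (c, (N c #>\<^bsub>H\<^esub> h) <#>\<^bsub>H\<^esub> C) else (c, C))" for h
  have coset: "N c #>\<^bsub>H\<^esub> h \<in> carrier (H Mod N c)" if "h \<in> carrier H" for h c
    using that by (simp add: carrier_FactGroup)
  have rc: "rcosets\<^bsub>H\<^esub> (N c) = carrier (H Mod N c)" for c by (simp add: FactGroup_def)
  have act_X: "act h (c, C) = (c, (N c #>\<^bsub>H\<^esub> h) \<otimes>\<^bsub>H Mod N c\<^esub> C)" if "(c, C) \<in> X" for h c C
    using that by (simp add: act_def)
  have act_notX: "act h x = x" if "x \<notin> X" for h x
    using that by (cases x) (simp add: act_def)
  have act_in: "act h x \<in> X" if "h \<in> carrier H" "x \<in> X" for h x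
    using that coset[of h] by (cases x) (auto simp: act_X simp del: mult_FactGroup, auto simp: X_def rc simp del: mult_FactGroup)
  have act_mult: "act (h \<otimes>\<^bsub>H\<^esub> h') x = act h (act h' x)" if "h \<in> carrier H" "h' \<in> carrier H" for h h' x
  proof (cases "x \<in> X")
    case True
    obtain c C where x: "x = (c, C)" by (cases x)
    have C: "C \<in> carrier (H Mod N c)" using True by (auto simp: x X_def rc)
    have "act h (act h' x) = (c, (N c #>\<^bsub>H\<^esub> h) \<otimes>\<^bsub>H Mod N c\<^esub> ((N c #>\<^bsub>H\<^esub> h') \<otimes>\<^bsub>H Mod N c\<^esub> C))"
      using act_in[OF that(2) True] True by (simp add: x act_X del: mult_FactGroup)
    also have "\<dots> = act (h \<otimes>\<^bsub>H\<^esub> h') x"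
      using True that C coset normal.rcos_sum[OF N(1), of h h' c]
      by (simp add: x act_X flip: Q.m_assoc del: mult_FactGroup) simp
    finally show ?thesis by simp
  qed (simp add: act_notX)
  have act_one: "act \<one>\<^bsub>H\<^esub> x = x" for x
  proof (cases "x \<in> X")
    case True
    obtain c C where x: "x = (c, C)" by (cases x)
    have C: "C \<in> carrier (H Mod N c)" using True by (auto simp: x X_def rc)
    have "N c #>\<^bsub>H\<^esub> \<one>\<^bsub>H\<^esub> = \<one>\<^bsub>H Mod N c\<^esub>"
      using subN by (simp add: subgroup.subset)
    then show ?thesis
      using True C by (simp add: x act_X del: mult_FactGroup one_FactGroup)
  qed (simp add: act_notX)
  have act_perm: "act h permutes X" if "h \<in> carrier H" for h
  proof (rule bij_imp_permutes)
    show "bij_betw (act h) X X"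
      using that act_in act_mult[of "inv\<^bsub>H\<^esub> h" h] act_mult[of h "inv\<^bsub>H\<^esub> h"]
      by (intro bij_betw_byWitness[of _ "act (inv\<^bsub>H\<^esub> h)"]) (auto simp: act_one)
  qed (rule act_notX)
  have act_hom: "act \<in> hom H P"
    using act_perm act_mult by (auto simp: hom_def P_def)

  \<comment> \<open>Values compose from the left, so the last letter acts first and the path runs
    from \<open>pt m\<close> down to \<open>pt 0\<close>. A coefficient at index \<open>i\<close>
    moves within level \<open>Suc i\<close>, from the trivial coset to that of the coefficient;
    since two coefficients are never adjacent, \<open>pt (Suc i)\<close> is indeed the trivial coset
    there.\<close>
  define pt where "pt i = (if i < m \<and> isl (w ! i) then (Suc i, N (Suc i) #>\<^bsub>H\<^esub> projl (w ! i)) else (i, N i))" for i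
  have N_in: "N c \<in> rcosets\<^bsub>H\<^esub> (N c)" for c
    using coset[OF H.one_closed, of c] subN by (simp add: rc subgroup.subset)
  have pt_in: "pt i \<in> X" if "i \<le> m" for i
    using that N_in coeff[of i] coset[of _ "Suc i"] by (auto simp: pt_def X_def rc isl_def simp flip: rc)
  have pt_eq: "pt (Suc i) = (Suc i, N (Suc i))" if "i < m" "isl (w ! i)" for i
    using that no_merge[of i] by (auto simp: pt_def)
  \<comment> \<open>Only neighbouring points can share a level, and then their cosets differ because
    the coefficient avoids \<open>N (Suc i)\<close>.\<close>
  have pt_inj: "i = j" if "pt i = pt j" "i \<le> j" for i j
  proof (rule ccontr)
    assume "i \<noteq> j"
    with that have ij: "j = Suc i" "i < m" "isl (w ! i)" "N (Suc i) #>\<^bsub>H\<^esub> projl (w ! i) = N (Suc i)"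
      by (auto simp: pt_def split: if_splits)
    then obtain h where h: "w ! i = Inl h" by (auto simp: isl_def)
    have "h \<in> N (Suc i) #>\<^bsub>H\<^esub> h" using coeff[OF ij(2) h] subN by (simp add: H.rcos_self)
    then show False using N(3)[OF ij(2) h] ij(4) h by simp
  qed
  have pt_inj': "pt i = pt j \<longleftrightarrow> i = j" for i j
    using pt_inj[of i j] pt_inj[of j i] by (cases "i \<le> j") auto

  define r where "r e = {(pt (Suc i), pt i) | i. i < m \<and> w ! i = Inr (e, True)}
    \<union> {(pt i, pt (Suc i)) | i. i < m \<and> w ! i = Inr (e, False)}" for e
  have "\<exists>f. f permutes X \<and> (\<forall>a b. (a, b) \<in> r e \<longrightarrow> f a = b)" for e
  proof -
    \<comment> \<open>Two different moves of \<open>e\<close> could share a source or a target only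
      at a point between adjacent letters \<open>e\<close> and its inverse, which reducedness
      excludes.\<close>
    have nc: "\<not> (Suc i < m \<and> w ! i = Inr (e, True) \<and> w ! Suc i = Inr (e, False))"
      "\<not> (Suc i < m \<and> w ! i = Inr (e, False) \<and> w ! Suc i = Inr (e, True))" for i
      using no_cancel[of i e True] no_cancel[of i e False] by auto
    have "r e \<subseteq> X \<times> X" unfolding r_def using pt_in by auto
    moreover have "single_valued (r e)"
    proof (rule single_valuedI)
      fix a b c assume "(a, b) \<in> r e" "(a, c) \<in> r e"
      then show "b = c"
        unfolding r_def by (elim UnE CollectE exE conjE) (use nc in \<open>auto simp: pt_inj'\<close>)
    qed
    moreover have "single_valued ((r e)\<inverse>)"
    proof (rule single_valuedI)
      fix a b c assume "(a, b) \<in> (r e)\<inverse>" "(a, c) \<in> (r e)\<inverse>"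
      then show "b = c"
        unfolding r_def converse_iff by (elim UnE CollectE exE conjE) (use nc in \<open>auto simp: pt_inj'\<close>)
    qed
    ultimately obtain f where "f permutes X" "\<And>a b. (a, b) \<in> r e \<Longrightarrow> f a = b"
      by (rule partial_injection_extends[OF \<open>finite X\<close>]) blast
    then show ?thesis by blast
  qed
  then obtain p where "\<forall>e. p e permutes X \<and> (\<forall>a b. (a, b) \<in> r e \<longrightarrow> p e a = b)"
    by (rule choice[OF allI, THEN exE])
  then have p: "\<And>e. p e permutes X" "\<And>e a b. (a, b) \<in> r e \<Longrightarrow> p e a = b"
    by blast+
  have i: "interp H P act p"
    unfolding interp_def using act_hom p(1) assms(1) P.is_group by (auto simp: P_def)
  have letter: "letter_value P act p (w ! i) (pt (Suc i)) = pt i" if "i < m" for i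
  proof (cases "w ! i")
    case (Inl h)
    then have l: "isl (w ! i)" by simp
    have "act h (pt (Suc i)) = (Suc i, (N (Suc i) #>\<^bsub>H\<^esub> h) \<otimes>\<^bsub>H Mod N (Suc i)\<^esub> N (Suc i))"
      using pt_in[of "Suc i"] that by (simp add: pt_eq[OF that l] act_X del: mult_FactGroup)
    also have "\<dots> = pt i"
      using that Inl coset[OF coeff[OF that Inl]] Q.r_one[of _ "Suc i"]
      by (simp add: pt_def del: mult_FactGroup)
    finally show ?thesis using Inl by simp
  next
    case (Inr eb)
    obtain e b where eb: "eb = (e, b)" by (cases eb)
    show ?thesis
    proof (cases b)
      case True
      then show ?thesis using Inr eb that p(2)[of "pt (Suc i)" "pt i" e] by (auto simp: r_def)
    next
      case False
      then have "p e (pt i) = pt (Suc i)"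
        using Inr eb that p(2)[of "pt i" "pt (Suc i)" e] by (auto simp: r_def)
      moreover have "(inv\<^bsub>P\<^esub> p e) \<circ> p e = id"
        using P.l_inv[of "p e"] p(1) by (simp add: P_def)
      then have "(inv\<^bsub>P\<^esub> p e) (p e (pt i)) = pt i" by (rule pointfree_idE)
      ultimately show ?thesis using Inr eb False by simp
    qed
  qed
  have "word_value P act p (drop i w) (pt m) = pt i" if "i \<le> m" for i
    using that
  proof (induction rule: inc_induct)
    case base
    then show ?case by (simp add: m_def P_def)
  next
    case (step n)
    have "drop n w = w ! n # drop (Suc n) w"
      using step by (simp add: m_def Cons_nth_drop_Suc)
    then show ?case using step letter[of n] by (simp add: P_def)
  qed
  from this[of 0] have "word_value P act p w (pt m) = pt 0" by simp
  moreover have "pt 0 \<noteq> pt m" using assms(4) by (simp add: pt_inj' m_def)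
  ultimately have "word_value P act p w \<noteq> \<one>\<^bsub>P\<^esub>" by (auto simp: P_def)
  then show ?thesis
    using i finite_perm_group[OF \<open>finite X\<close>] unfolding P_def by blast
qed

text \<open>Contractions preserve values, so nontriviality in the auxiliary group \<open>G\<close>
  survives down to a reduced word, which is therefore not empty and is detected by the path
  action.\<close>

lemma word_detected_free:
  fixes H :: "('h, 'm) monoid_scheme" and w :: "('h + 'e \<times> bool) list"
  assumes "group H" "residually_finite H" "coeffs w \<subseteq> carrier H"
    and "interp H G \<sigma> q" "word_value G \<sigma> q w \<noteq> \<one>\<^bsub>G\<^esub>"
  shows "\<exists>(P :: (nat \<times> 'h set \<Rightarrow> nat \<times> 'h set) monoid) \<rho> p.
    interp H P \<rho> p \<and> finite (carrier P) \<and> word_value P \<rho> p w \<noteq> \<one>\<^bsub>P\<^esub>"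
  using assms(3,5)
proof (induction w rule: length_induct)
  case (1 w)
  show ?case
  proof (cases "\<exists>w'. contracts H w w'")
    case True
    then obtain w' where w': "contracts H w w'" by blast
    have c: "coeffs w' \<subseteq> carrier H" using contracts_coeffs[OF w' assms(1) 1(2)] .
    have "word_value G \<sigma> q w' \<noteq> \<one>\<^bsub>G\<^esub>"
      using 1(3) word_value_contracts[OF w' assms(4) 1(2)] by simp
    then obtain P :: "(nat \<times> 'h set \<Rightarrow> nat \<times> 'h set) monoid" and \<rho> p
      where P: "interp H P \<rho> p" "finite (carrier P)" "word_value P \<rho> p w' \<noteq> \<one>\<^bsub>P\<^esub>"
      using 1(1) c contracts_length[OF w'] by blast
    then have "word_value P \<rho> p w \<noteq> \<one>\<^bsub>P\<^esub>"
      using word_value_contracts[OF w' P(1) 1(2)] by simp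
    then show ?thesis using P by blast
  next
    case False
    moreover have "w \<noteq> []" using 1(3) by auto
    ultimately show ?thesis using reduced_word_detected[OF assms(1,2) 1(2)] by blast
  qed
qed

text \<open>The relators form a triangular system: \<open>e i\<close> is absent from the earlier
  ones. Eliminating the last relator first changes \<open>w\<close> but no other relator, and its
  letter is labelled afterwards without disturbing them.\<close>

lemma word_detected:
  fixes H :: "('h, 'm) monoid_scheme" and w :: "('h + 'e \<times> bool) list" and n :: nat
  assumes "group H" "residually_finite H" "coeffs w \<subseteq> carrier H"
    and "interp H G \<sigma> q" "word_value G \<sigma> q w \<noteq> \<one>\<^bsub>G\<^esub>"
    and "\<And>i. i < n \<Longrightarrow> coeffs (r i) \<subseteq> carrier H"
    and "\<And>i. i < n \<Longrightarrow> word_value G \<sigma> q (r i) = \<one>\<^bsub>G\<^esub>"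
    and "\<And>i. i < n \<Longrightarrow> occurs_once (e i) (r i)"
    and "\<And>i j. j < i \<Longrightarrow> i < n \<Longrightarrow> e i \<notin> edges (r j)"
  shows "\<exists>(P :: (nat \<times> 'h set \<Rightarrow> nat \<times> 'h set) monoid) \<rho> p.
    interp H P \<rho> p \<and> finite (carrier P) \<and> word_value P \<rho> p w \<noteq> \<one>\<^bsub>P\<^esub>
      \<and> (\<forall>i<n. word_value P \<rho> p (r i) = \<one>\<^bsub>P\<^esub>)"
  using assms(3,5-9)
proof (induction n arbitrary: w)
  case 0
  then show ?case using word_detected_free[OF assms(1,2) 0(1) assms(4)] by simp
next
  case (Suc n)
  let ?e = "e n"
  have once: "occurs_once ?e (r n)" and cr: "coeffs (r n) \<subseteq> carrier H" using Suc.prems by auto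
  from once obtain u b v where rn: "r n = u @ Inr (?e, b) # v" "?e \<notin> edges u" "?e \<notin> edges v"
    unfolding occurs_once_def by blast
  have c: "coeffs u \<subseteq> carrier H" "coeffs v \<subseteq> carrier H" using cr rn by auto
  define s where "s = solution H u b v"
  have s: "coeffs s \<subseteq> carrier H" "?e \<notin> edges s"
    using rn coeffs_solution[OF assms(1) c] by (simp_all add: s_def edges_solution)
  note solve = word_value_solution_iff[OF _ c, where e = ?e and b = b, folded rn(1) s_def]
  let ?w = "word_subst ?e H s w"
  \<comment> \<open>The relator holds in \<open>G\<close>, so \<open>q\<close> already gives this
    letter its forced value and the substitution leaves the value of \<open>w\<close> in
    \<open>G\<close> unchanged.\<close>
  have "q(?e := word_value G \<sigma> q s) = q"
    using solve[OF assms(4)] Suc.prems(4)[of n] by auto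
  then have "word_value G \<sigma> q ?w \<noteq> \<one>\<^bsub>G\<^esub>"
    using word_value_subst[OF assms(4) s(1) Suc.prems(1), of ?e] Suc.prems(2) by simp
  moreover have "coeffs ?w \<subseteq> carrier H"
    using coeffs_word_subst[OF assms(1) s(1) Suc.prems(1)] .
  ultimately have "\<exists>(P :: (nat \<times> 'h set \<Rightarrow> nat \<times> 'h set) monoid) \<rho> p.
      interp H P \<rho> p \<and> finite (carrier P) \<and> word_value P \<rho> p ?w \<noteq> \<one>\<^bsub>P\<^esub>
        \<and> (\<forall>i<n. word_value P \<rho> p (r i) = \<one>\<^bsub>P\<^esub>)"
    using Suc.prems(3-6) by (intro Suc.IH) auto
  then obtain P :: "(nat \<times> 'h set \<Rightarrow> nat \<times> 'h set) monoid" and \<rho> p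
    where P: "interp H P \<rho> p" "finite (carrier P)" "word_value P \<rho> p ?w \<noteq> \<one>\<^bsub>P\<^esub>"
      "\<And>i. i < n \<Longrightarrow> word_value P \<rho> p (r i) = \<one>\<^bsub>P\<^esub>"
    by blast
  let ?p = "p(?e := word_value P \<rho> p s)"
  have i: "interp H P \<rho> ?p" using P(1) word_value_closed[OF P(1) s(1)] by (rule interp_upd)
  have "word_value P \<rho> ?p w \<noteq> \<one>\<^bsub>P\<^esub>"
    using word_value_subst[OF P(1) s(1) Suc.prems(1), of ?e] P(3) by simp
  moreover have "word_value P \<rho> ?p (r i) = \<one>\<^bsub>P\<^esub>" if "i < Suc n" for i
  proof (cases "i = n")
    case True
    then show ?thesis by (simp add: solve[OF i] word_value_upd[OF s(2)])
  next
    case False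
    then show ?thesis using P(4)[of i] Suc.prems(6)[of i n] that by (simp add: word_value_upd)
  qed
  ultimately show ?case using i P(2) by blast
qed

section \<open>Labellings of windows and their extension\<close>

abbreviation translate :: "int \<Rightarrow> ('h + (int \<times> 'x) \<times> bool) list \<Rightarrow> ('h + (int \<times> 'x) \<times> bool) list" where
  "translate n \<equiv> map_edges (\<lambda>(m, x). (m + n, x))"

text \<open>The edge \<open>(m, x)\<close> joins the heights \<open>m\<close> and \<open>m + s x\<close>. The relators are the translates of a word
  living between the heights \<open>0\<close> and \<open>d\<close>; each is solvable both for an edge ending at its top and for
  an edge starting at its bottom.\<close>

locale band =
  fixes H :: "('h, 'm) monoid_scheme" and P :: "('p, 'n) monoid_scheme" and \<rho> :: "'h \<Rightarrow> 'p"
    and V :: "'x set" and s :: "'x \<Rightarrow> int" and L d :: int and y z :: 'x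
    and W :: "('h + (int \<times> 'x) \<times> bool) list"
  assumes groups: "group H" "group P" "\<rho> \<in> hom H P"
    and coeffs_W: "coeffs W \<subseteq> carrier H"
    and edges_W: "edges W \<subseteq> {(m, x). x \<in> V \<and> 0 \<le> m \<and> m + s x \<le> d}"
    and top_once: "occurs_once (d - s y, y) W"
    and bottom_once: "occurs_once (0, z) W"
    and span_pos: "x \<in> V \<Longrightarrow> 0 < s x"
    and span_le: "x \<in> V \<Longrightarrow> s x \<le> L"
    and d_le: "d \<le> L"
begin

definition window :: "(int \<times> 'x) set" where
  "window = {(m, x). x \<in> V \<and> 0 \<le> m \<and> m + s x \<le> L}"

text \<open>The default 1 off the window lets equality of states mean equality on the window. The
  relators required are the translates lying entirely between the heights 0 and
  \<open>L\<close>.\<close>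

definition state :: "(int \<times> 'x \<Rightarrow> 'p) \<Rightarrow> bool" where
  "state f \<longleftrightarrow> range f \<subseteq> carrier P \<and> (\<forall>e. e \<notin> window \<longrightarrow> f e = \<one>\<^bsub>P\<^esub>) \<and>
    (\<forall>n. 0 \<le> n \<and> n + d \<le> L \<longrightarrow> word_value P \<rho> f (translate n W) = \<one>\<^bsub>P\<^esub>)"

text \<open>Shifting the window by one drops the labels of the edges \<open>(0, x)\<close> and reuses them for the new top edges.
  The transposition skips the label of \<open>(0, z)\<close>, which the lowest relator determines, and leaves that of
  \<open>(L - s y, y)\<close> to be determined by the highest relator.\<close>

definition succ_state :: "(int \<times> 'x \<Rightarrow> 'p) \<Rightarrow> (int \<times> 'x \<Rightarrow> 'p) \<Rightarrow> bool" where
  "succ_state f f' \<longleftrightarrow> state f \<and> state f' \<and>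
    (\<forall>m x. x \<in> V \<and> 0 \<le> m \<and> m + s x < L \<longrightarrow> f' (m, x) = f (m + 1, x)) \<and>
    (\<forall>x\<in>V. x \<noteq> y \<longrightarrow> f' (L - s x, x) = f (0, transpose y z x))"

lemma occurs_once_in_edges: "occurs_once e w \<Longrightarrow> e \<in> edges w"
  by (auto simp: occurs_once_def)

lemma y_in_V: "y \<in> V" and z_in_V: "z \<in> V"
  using top_once bottom_once edges_W occurs_once_in_edges by fast+

lemma interpI: "range f \<subseteq> carrier P \<Longrightarrow> interp H P \<rho> f"
  by (simp add: interp_def groups)

lemma edges_translate: "(m, x) \<in> edges (translate n W) \<Longrightarrow> x \<in> V \<and> n \<le> m \<and> m + s x \<le> n + d"
  using edges_W by auto

lemma word_value_translate: "word_value P \<rho> f (translate n W) = word_value P \<rho> (\<lambda>(m, x). f (m + n, x)) W"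
  by (simp add: word_value_map_edges case_prod_unfold)

text \<open>The successor is forced everywhere except at the top edge \<open>?top\<close>. All its
  relators but the highest are relators of \<open>f\<close> shifted by one; the highest contains
  \<open>?top\<close> once and so determines its label.\<close>

lemma ex1_succ_state:
  assumes "state f"
  shows "\<exists>!f'. succ_state f f'"
proof -
  interpret P: group P by (rule groups)
  have f: "f e \<in> carrier P" for e using assms unfolding state_def by auto
  let ?top = "(L - s y, y)"
  \<comment> \<open>At \<open>?top\<close> this yields \<open>f (0, z)\<close>, a mere placeholder
    that every use of \<open>g(?top := v)\<close> overwrites.\<close>
  define g where "g = (\<lambda>(m, x). if (m, x) \<in> window then if m + s x < L then f (m + 1, x)
    else f (0, transpose y z x) else \<one>\<^bsub>P\<^esub>)"
  have g: "range g \<subseteq> carrier P" using f by (auto simp: g_def)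
  have succ_upd: "f' = g(?top := f' ?top)" if "succ_state f f'" for f'
  proof (rule ext)
    fix e :: "int \<times> 'x"
    obtain m x where e: "e = (m, x)" by (cases e)
    have "e = ?top \<or> e \<notin> window \<or> (x \<in> V \<and> 0 \<le> m \<and> m + s x < L) \<or> (x \<in> V \<and> x \<noteq> y \<and> m = L - s x)"
      unfolding e window_def by auto
    then show "f' e = (g(?top := f' ?top)) e"
      using that span_le unfolding succ_state_def state_def by (auto simp: e g_def window_def)
  qed
  have succ_iff: "succ_state f (g(?top := v)) \<longleftrightarrow>
      word_value P \<rho> (g(?top := v)) (translate (L - d) W) = \<one>\<^bsub>P\<^esub>" if v: "v \<in> carrier P" for v
  proof
    assume "succ_state f (g(?top := v))"
    then show "word_value P \<rho> (g(?top := v)) (translate (L - d) W) = \<one>\<^bsub>P\<^esub>"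
      using d_le unfolding succ_state_def state_def by simp
  next
    assume *: "word_value P \<rho> (g(?top := v)) (translate (L - d) W) = \<one>\<^bsub>P\<^esub>"
    have "word_value P \<rho> (g(?top := v)) (translate n W) = \<one>\<^bsub>P\<^esub>" if n: "0 \<le> n" "n + d \<le> L" for n
    proof (cases "n + d = L")
      case True
      then have "n = L - d" by simp
      then show ?thesis using * by (simp only:)
    next
      case False
      have "word_value P \<rho> (g(?top := v)) (translate n W) = word_value P \<rho> f (translate (n + 1) W)"
        unfolding word_value_translate
      proof (rule word_value_cong)
        fix e assume "e \<in> edges W"
        then obtain m x where e: "e = (m, x)" "x \<in> V" "0 \<le> m" "m + s x \<le> d" using edges_W by auto
        then have "(m + n, x) \<in> window" "m + n + s x < L" "(m + n, x) \<noteq> ?top"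
          using n False by (auto simp: window_def)
        then show "(case e of (m, x) \<Rightarrow> (g(?top := v)) (m + n, x)) = (case e of (m, x) \<Rightarrow> f (m + (n + 1), x))"
          by (auto simp: e g_def add.assoc)
      qed simp
      also have "\<dots> = \<one>\<^bsub>P\<^esub>" using assms n False unfolding state_def by auto
      finally show ?thesis .
    qed
    moreover have "range (g(?top := v)) \<subseteq> carrier P" using g v by auto
    moreover have "(g(?top := v)) e = \<one>\<^bsub>P\<^esub>" if "e \<notin> window" for e
    proof -
      have "?top \<in> window" using y_in_V span_le by (simp add: window_def)
      then show ?thesis using that by (cases e) (auto simp: g_def)
    qed
    ultimately have "state (g(?top := v))" unfolding state_def by blast
    then show "succ_state f (g(?top := v))"
      using assms span_le unfolding succ_state_def by (auto simp: g_def window_def)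
  qed
  have "occurs_once ((\<lambda>(m, x). (m + (L - d), x)) (d - s y, y)) (translate (L - d) W)"
    by (rule occurs_once_map_edges[OF _ top_once]) (auto intro: injI)
  then have "occurs_once ?top (translate (L - d) W)" by simp
  from occurs_once_solvable[OF interpI[OF g] this]
  have "\<exists>!v. v \<in> carrier P \<and> word_value P \<rho> (g(?top := v)) (translate (L - d) W) = \<one>\<^bsub>P\<^esub>"
    using coeffs_W by simp
  then obtain v where v: "v \<in> carrier P" "succ_state f (g(?top := v))"
    "\<And>u. u \<in> carrier P \<Longrightarrow> succ_state f (g(?top := u)) \<Longrightarrow> u = v"
    using succ_iff by metis
  show ?thesis
  proof (rule ex1I[of "succ_state f", OF v(2)])
    fix f' assume f': "succ_state f f'"
    have "f' ?top \<in> carrier P" using f' unfolding succ_state_def state_def by auto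
    moreover have "succ_state f (g(?top := f' ?top))" using f' succ_upd[OF f'] by simp
    ultimately have "f' ?top = v" by (rule v(3))
    then show "f' = g(?top := v)" using succ_upd[OF f'] by simp
  qed
qed

text \<open>Heights \<open>h\<close> become \<open>k - h\<close>. The edge from \<open>m\<close> to
  \<open>m + s x\<close> then has lower end \<open>k - s x - m\<close>, and edges are named by their
  lower end.\<close>

definition reflect :: "int \<Rightarrow> int \<times> 'x \<Rightarrow> int \<times> 'x" where
  "reflect k = (\<lambda>(m, x). (k - s x - m, x))"

lemma reflect_reflect [simp]: "reflect k (reflect k e) = e"
  by (cases e) (simp add: reflect_def)

text \<open>The axioms of \<open>band\<close> are symmetric under reversing the heights, with
  \<open>y\<close> and \<open>z\<close> exchanged. Only edges are renamed; the order and the signs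
  of the letters stay.\<close>

lemma band_reflect: "band H P \<rho> V s L d z y (map_edges (reflect d) W)"
proof (rule band.intro)
  have inj: "inj (reflect d)" by (metis injI reflect_reflect)
  show "occurs_once (d - s z, z) (map_edges (reflect d) W)"
    using occurs_once_map_edges[OF inj bottom_once] by (simp add: reflect_def)
  show "occurs_once (0, y) (map_edges (reflect d) W)"
    using occurs_once_map_edges[OF inj top_once] by (simp add: reflect_def)
  show "edges (map_edges (reflect d) W) \<subseteq> {(m, x). x \<in> V \<and> 0 \<le> m \<and> m + s x \<le> d}"
    using edges_W by (auto simp: reflect_def)
qed (use groups coeffs_W span_pos span_le d_le in auto)

text \<open>A predecessor is a successor in the reflected band: the translate by \<open>n\<close>
  reflects to the translate by \<open>L - d - n\<close>.\<close>

lemma ex1_pred_state: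
  assumes "state f'"
  shows "\<exists>!f. succ_state f f'"
proof -
  interpret R: band H P \<rho> V s L d z y "map_edges (reflect d) W" by (rule band_reflect)
  have inv: "(f \<circ> reflect L) \<circ> reflect L = f" for f :: "int \<times> 'x \<Rightarrow> 'p" by (simp add: o_def)
  have reflected: "word_value P \<rho> (f \<circ> reflect L) (translate n (map_edges (reflect d) W))
      = word_value P \<rho> f (translate (L - d - n) W)" for f n
    unfolding word_value_translate word_value_map_edges
    by (rule word_value_cong) (auto simp: reflect_def algebra_simps)
  have win: "reflect L e \<in> window \<longleftrightarrow> e \<in> R.window" for e
    by (auto simp: reflect_def window_def R.window_def)
  have state: "R.state (f \<circ> reflect L)" if "state f" for f
  proof -
    have "(f \<circ> reflect L) e = \<one>\<^bsub>P\<^esub>" if "e \<notin> R.window" for e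
      using \<open>state f\<close> win[of e] that unfolding state_def comp_apply by blast
    then show ?thesis
      using that unfolding state_def R.state_def reflected by auto
  qed
  have state_iff: "R.state (f \<circ> reflect L) \<longleftrightarrow> state f" for f
  proof
    assume *: "R.state (f \<circ> reflect L)"
    have "word_value P \<rho> f (translate n W) = \<one>\<^bsub>P\<^esub>" if "0 \<le> n" "n + d \<le> L" for n
      using * reflected[of f "L - d - n"] that unfolding R.state_def by auto
    moreover have "f e \<in> carrier P" for e
    proof -
      have "(f \<circ> reflect L) (reflect L e) \<in> carrier P" using * unfolding R.state_def by blast
      then show ?thesis by simp
    qed
    moreover have "f e = \<one>\<^bsub>P\<^esub>" if "e \<notin> window" for e
    proof -
      have "reflect L e \<notin> R.window" using that win[of "reflect L e"] by simp
      then have "(f \<circ> reflect L) (reflect L e) = \<one>\<^bsub>P\<^esub>" using * unfolding R.state_def by blast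
      then show ?thesis by simp
    qed
    ultimately show "state f" unfolding state_def by fast
  qed (rule state)
  have succ: "R.succ_state (f' \<circ> reflect L) (f \<circ> reflect L) \<longleftrightarrow> succ_state f f'" for f f'
  proof -
    have "(\<forall>m x. x \<in> V \<and> 0 \<le> m \<and> m + s x < L \<longrightarrow> f (L - s x - m, x) = f' (L - s x - (m + 1), x)) \<longleftrightarrow>
      (\<forall>m x. x \<in> V \<and> 0 \<le> m \<and> m + s x < L \<longrightarrow> f' (m, x) = f (m + 1, x))" (is "?l \<longleftrightarrow> ?r")
    proof
      assume l: ?l
      show ?r
      proof (intro allI impI)
        fix m x assume "x \<in> V \<and> 0 \<le> m \<and> m + s x < L"
        then show "f' (m, x) = f (m + 1, x)" using l[rule_format, of x "L - s x - m - 1"] by simp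
      qed
    next
      assume r: ?r
      show ?l
      proof (intro allI impI)
        fix m x assume "x \<in> V \<and> 0 \<le> m \<and> m + s x < L"
        then show "f (L - s x - m, x) = f' (L - s x - (m + 1), x)"
          using r[rule_format, of x "L - s x - (m + 1)"] by (simp add: algebra_simps)
      qed
    qed
    \<comment> \<open>The transposition is an involution matching the generators other than
      \<open>y\<close> with those other than \<open>z\<close>, so the recycling rule reflects to
      itself.\<close>
    moreover have "(\<forall>x\<in>V. x \<noteq> z \<longrightarrow> f (0, x) = f' (L - s (transpose z y x), transpose z y x)) \<longleftrightarrow>
      (\<forall>x\<in>V. x \<noteq> y \<longrightarrow> f' (L - s x, x) = f (0, transpose y z x))" (is "?l \<longleftrightarrow> ?r")
    proof
      assume l: ?l
      show ?r
      proof (intro ballI impI)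
        fix x assume x: "x \<in> V" "x \<noteq> y"
        have "transpose y z x \<in> V" "transpose y z x \<noteq> z"
          using x y_in_V z_in_V by (auto simp: transpose_def)
        from l[rule_format, OF this] show "f' (L - s x, x) = f (0, transpose y z x)"
          by (simp add: transpose_commute[of z y])
      qed
    next
      assume r: ?r
      show ?l
      proof (intro ballI impI)
        fix x assume x: "x \<in> V" "x \<noteq> z"
        have "transpose y z x \<in> V" "transpose y z x \<noteq> y"
          using x y_in_V z_in_V by (auto simp: transpose_def)
        from r[rule_format, OF this]
        show "f (0, x) = f' (L - s (transpose z y x), transpose z y x)"
          by (simp add: transpose_commute[of z y])
      qed
    qed
    ultimately show ?thesis
      unfolding R.succ_state_def succ_state_def state_iff by (auto simp: reflect_def)
  qed
  from R.ex1_succ_state[of "f' \<circ> reflect L"] assms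
  obtain h where h: "R.succ_state (f' \<circ> reflect L) h"
    "\<And>h'. R.succ_state (f' \<circ> reflect L) h' \<Longrightarrow> h' = h"
    unfolding state_iff by blast
  have "succ_state (h \<circ> reflect L) f'" using h(1) succ[of f' "h \<circ> reflect L"] by (simp only: inv)
  moreover have "f = h \<circ> reflect L" if "succ_state f f'" for f
    using h(2)[of "f \<circ> reflect L"] succ[of f' f] that inv[of f] by simp
  ultimately show ?thesis by blast
qed

end

section \<open>Two-sided orbits of bijections\<close>

lemma two_sided_orbit:
  assumes "bij_betw T S S" "f \<in> S"
  obtains F :: "int \<Rightarrow> 'a" where "F 0 = f" "\<And>n. F n \<in> S" "\<And>n. F (n + 1) = T (F n)"
proof -
  define T' where "T' = inv_into S T"
  have T': "T' g \<in> S" "T (T' g) = g" if "g \<in> S" for g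
    using that assms(1) unfolding T'_def bij_betw_def by (auto simp: inv_into_into f_inv_into_f)
  have T: "T g \<in> S" if "g \<in> S" for g using that assms(1) by (auto simp: bij_betw_def)
  have it: "(T ^^ n) f \<in> S" for n by (induction n) (use T assms(2) in auto)
  have it': "(T' ^^ n) f \<in> S" for n by (induction n) (use T' assms(2) in auto)
  define F where "F n = (if 0 \<le> n then (T ^^ nat n) f else (T' ^^ nat (- n)) f)" for n :: int
  have "F (n + 1) = T (F n)" for n
  proof (cases "0 \<le> n")
    case True
    then show ?thesis by (simp add: F_def nat_add_distrib)
  next
    case False
    define k where "k = nat (- n - 1)"
    have k: "nat (- n) = Suc k" using False by (simp add: k_def)
    have "T (F n) = (T' ^^ k) f" using False T'(2)[OF it'[of k]] by (simp add: F_def k)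
    also have "\<dots> = F (n + 1)"
    proof (cases "n = -1")
      case True
      then show ?thesis by (simp add: F_def k_def)
    next
      case False2: False
      then have "nat (- (n + 1)) = k" "\<not> 0 \<le> n + 1" using False by (simp_all add: k_def)
      then show ?thesis by (simp add: F_def)
    qed
    finally show ?thesis by simp
  qed
  moreover have "F 0 = f" "F n \<in> S" for n using it it' by (simp_all add: F_def)
  ultimately show thesis using that by blast
qed

text \<open>The pigeonhole principle gives one coincidence; applying \<open>T\<close> carries it
  forwards and injectivity carries it backwards, so the period holds on all integers.\<close>

lemma orbit_periodic:
  fixes F :: "int \<Rightarrow> 'a"
  assumes "inj_on T S" "finite S" "\<And>n. F n \<in> S" "\<And>n. F (n + 1) = T (F n)"
  obtains N where "0 < N" "\<And>n. F (n + N) = F n"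
proof -
  have "\<not> inj_on (F \<circ> int) UNIV"
    using assms(2,3) by (metis finite_subset finite_imageD image_subsetI comp_apply infinite_UNIV_nat)
  then obtain i j where ij: "i < j" "F (int i) = F (int j)"
    unfolding inj_on_def by (metis comp_apply linorder_neqE_nat)
  define N where "N = int j - int i"
  have N: "0 < N" using ij by (simp add: N_def)
  have "F (int i + k + N) = F (int i + k)" for k
  proof (induction k rule: int_induct[of _ 0])
    case base
    then show ?case using ij by (simp add: N_def)
  next
    case (step1 k)
    then show ?case using assms(4)[of "int i + k + N"] assms(4)[of "int i + k"] by (simp add: algebra_simps)
  next
    case (step2 k)
    have "T (F (int i + (k - 1) + N)) = T (F (int i + (k - 1)))"
      using step2 assms(4)[of "int i + (k - 1) + N"] assms(4)[of "int i + (k - 1)"]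
      by (simp add: algebra_simps)
    then show ?case using assms(1,3) by (metis inj_onD)
  qed
  from this[of "n - int i" for n] have "F (n + N) = F n" for n by simp
  then show thesis using N that by blast
qed

context band
begin

lemma finite_states:
  assumes "finite V" "finite (carrier P)"
  shows "finite {f. state f}"
proof (rule finite_subset)
  have "window \<subseteq> (\<Union>x\<in>V. (\<lambda>m. (m, x)) ` {0..L})"
    using span_pos by (force simp: window_def)
  then have "finite window" using assms(1) finite_subset by blast
  then show "finite {f. \<forall>e. (e \<in> window \<longrightarrow> f e \<in> carrier P) \<and> (e \<notin> window \<longrightarrow> f e = \<one>\<^bsub>P\<^esub>)}"
    using assms(2) by (rule finite_set_of_finite_funs)
qed (auto simp: state_def)

text \<open>The states along the orbit of \<open>f\<close> are overlapping windows of one labelling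
  of the whole graph. Every translate of the relator sits at the bottom of one of these windows,
  where it is known to hold.\<close>

lemma state_extends:
  assumes "state f"
  obtains q N where "\<And>e. q e \<in> carrier P" "\<And>e. e \<in> window \<Longrightarrow> q e = f e"
    "\<And>n. word_value P \<rho> q (translate n W) = \<one>\<^bsub>P\<^esub>"
    "\<And>m x. q (m + N, x) = q (m, x)" "0 \<le> N" "finite V \<Longrightarrow> finite (carrier P) \<Longrightarrow> 0 < N"
proof -
  let ?S = "{f. state f}"
  define T where "T f = (THE f'. succ_state f f')" for f
  have T: "succ_state g (T g)" if "state g" for g
    unfolding T_def using ex1_succ_state[OF that] by (rule theI')
  have T_eq: "T g = g'" if "succ_state g g'" for g g'
  proof -
    have "state g" using that unfolding succ_state_def by blast
    then show ?thesis unfolding T_def using that by (rule the1_equality[OF ex1_succ_state])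
  qed
  have bij: "bij_betw T ?S ?S"
  proof (rule bij_betwI')
    fix g g' assume "g \<in> ?S" "g' \<in> ?S"
    then have g: "succ_state g (T g)" "succ_state g' (T g')" using T by simp_all
    then have "\<exists>!h. succ_state h (T g)" unfolding succ_state_def[of g] by (intro ex1_pred_state) blast
    then show "T g = T g' \<longleftrightarrow> g = g'" using g by auto
  next
    fix g assume "g \<in> ?S"
    then show "T g \<in> ?S" using T[of g] by (simp add: succ_state_def)
  next
    fix g' assume "g' \<in> ?S"
    then obtain g where g: "succ_state g g'" using ex1_pred_state[of g'] by auto
    then have "state g" unfolding succ_state_def by blast
    then show "\<exists>g\<in>?S. g' = T g" using T_eq[OF g] by blast
  qed
  from two_sided_orbit[OF bij, of f] assms obtain F :: "int \<Rightarrow> int \<times> 'x \<Rightarrow> 'p" where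
    F: "F 0 = f" "\<And>n. state (F n)" "\<And>n. F (n + 1) = T (F n)" by auto
  have succ: "succ_state (F n) (F (n + 1))" for n using T[OF F(2)] F(3) by simp
  \<comment> \<open>\<open>N = 0\<close> stands for the absence of a period, matching the convention
    of taking residues modulo 0.\<close>
  have "\<exists>N. 0 \<le> N \<and> (\<forall>n. F (n + N) = F n) \<and> (finite V \<and> finite (carrier P) \<longrightarrow> 0 < N)"
  proof (cases "finite V \<and> finite (carrier P)")
    case True
    then obtain N where "0 < N" "\<And>n. F (n + N) = F n"
      using orbit_periodic[OF bij_betw_imp_inj_on[OF bij] finite_states, of F] F by auto
    then show ?thesis by (intro exI[of _ N]) auto
  qed (intro exI[of _ 0], auto)
  then obtain N where N: "0 \<le> N" "\<And>n. F (n + N) = F n" "finite V \<Longrightarrow> finite (carrier P) \<Longrightarrow> 0 < N"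
    by blast
  \<comment> \<open>The label of an edge is read at the bottom of the window that starts at its
    lower end; sliding the window shows that every other window containing the edge agrees.\<close>
  define q where "q = (\<lambda>(m, x). F m (0, x))"
  have move: "F n (int j, x) = F (n + int j) (0, x)" if "x \<in> V" "int j + s x \<le> L" for n j x
    using that
  proof (induction j arbitrary: n)
    case (Suc j)
    have "F n (int (Suc j), x) = F (n + 1) (int j, x)"
      using succ[of n] Suc.prems by (simp add: succ_state_def add.commute)
    then show ?case using Suc by (simp add: ac_simps)
  qed simp
  have q_eq: "q (m + n, x) = F n (m, x)" if "(m, x) \<in> window" for n m x
    using move[of x "nat m" n] that by (simp add: q_def window_def add.commute)
  show thesis
  proof (rule that[of q N])
    show "q e \<in> carrier P" for e
    proof -
      have "range (F n) \<subseteq> carrier P" for n using F(2) unfolding state_def by blast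
      then show ?thesis by (cases e) (auto simp: q_def)
    qed
    show "q e = f e" if "e \<in> window" for e
      using q_eq[of _ _ 0] that F(1) by (cases e) simp
    show "word_value P \<rho> q (translate n W) = \<one>\<^bsub>P\<^esub>" for n
    proof -
      have "word_value P \<rho> q (translate n W) = word_value P \<rho> (F n) (translate 0 W)"
        unfolding word_value_translate
        by (rule word_value_cong) (use edges_W d_le in \<open>auto simp: window_def intro!: q_eq\<close>)
      also have "\<dots> = \<one>\<^bsub>P\<^esub>"
      proof -
        have "(0::int) \<le> 0 \<and> 0 + d \<le> L" using d_le by simp
        then show ?thesis using F(2)[of n] unfolding state_def by blast
      qed
      finally show ?thesis .
    qed
    show "q (m + N, x) = q (m, x)" for m x using N(2) by (simp add: q_def)
  qed (use N in auto)
qed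

end

section \<open>Wreath products\<close>

fun letter_weight :: "('x \<Rightarrow> int) \<Rightarrow> 'x \<times> bool \<Rightarrow> int" where
  "letter_weight \<theta> (x, b) = (if b then \<theta> x else - \<theta> x)"

fun weight :: "('x \<Rightarrow> int) \<Rightarrow> ('h + 'x \<times> bool) list \<Rightarrow> int" where
  "weight \<theta> [] = 0"
| "weight \<theta> (Inl h # w) = weight \<theta> w"
| "weight \<theta> (Inr a # w) = letter_weight \<theta> a + weight \<theta> w"

text \<open>An edge of the lifted path is named by its lower end, whatever the sign of \<open>\<theta> x\<close>, and its letter.\<close>

fun lift :: "('x \<Rightarrow> int) \<Rightarrow> int \<Rightarrow> ('h + 'x \<times> bool) list \<Rightarrow> ('h + (int \<times> 'x) \<times> bool) list" where
  "lift \<theta> n [] = []"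
| "lift \<theta> n (Inl h # w) = Inl h # lift \<theta> n w"
| "lift \<theta> n (Inr (x, b) # w) =
     Inr ((min n (n + letter_weight \<theta> (x, b)), x), b) # lift \<theta> (n + letter_weight \<theta> (x, b)) w"

lemma weight_append [simp]: "weight \<theta> (u @ v) = weight \<theta> u + weight \<theta> v"
  by (induction u rule: word_induct) auto

lemma lift_append: "lift \<theta> n (u @ v) = lift \<theta> n u @ lift \<theta> (n + weight \<theta> u) v"
  by (induction u arbitrary: n rule: word_induct) (auto simp: add.assoc)

lemma coeffs_lift [simp]: "coeffs (lift \<theta> n w) = coeffs w"
  by (induction w arbitrary: n rule: word_induct) auto

lemma edges_lift: "(m, x) \<in> edges (lift \<theta> n w) \<Longrightarrow> x \<in> edges w"
  by (induction w arbitrary: n rule: word_induct) auto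

lemma lift_translate: "lift \<theta> (n + c) w = translate c (lift \<theta> n w)"
proof (induction w arbitrary: n rule: word_induct)
  case (Inr x b w)
  have eq: "n + c + letter_weight \<theta> (x, b) = n + letter_weight \<theta> (x, b) + c" by simp
  then show ?case
    unfolding lift.simps eq Inr by (simp add: min_add_distrib_left id_def del: letter_weight.simps)
qed auto

text \<open>Forgetting heights makes any group with generators a labelling of the whole graph, in
  particular the presented group.\<close>

lemma word_value_lift: "word_value G \<sigma> (\<lambda>(m, x). \<gamma> x) (lift \<theta> n w) = word_value G \<sigma> \<gamma> w"
  by (induction w arbitrary: n rule: word_induct) auto

text \<open>For \<open>N > 0\<close> this is the wreath product of \<open>P\<close> with the cyclic group of order \<open>N\<close>; for \<open>N = 0\<close> it is the
  unrestricted wreath product with the integers, because \<open>a mod 0 = a\<close>.\<close>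

definition wreath :: "int \<Rightarrow> ('p, 'n) monoid_scheme \<Rightarrow> (int \<times> (int \<Rightarrow> 'p)) monoid" where
  "wreath N P =
    \<lparr> carrier = {(a, f). a mod N = a \<and> range f \<subseteq> carrier P \<and> (\<forall>m. f (m + N) = f m)},
      monoid.mult = (\<lambda>(a, f) (b, g). ((a + b) mod N, \<lambda>m. f m \<otimes>\<^bsub>P\<^esub> g (m + a))),
      one = (0, \<lambda>m. \<one>\<^bsub>P\<^esub>) \<rparr>"

lemma periodic_mod:
  fixes f :: "int \<Rightarrow> 'a"
  assumes "\<And>m. f (m + N) = f m"
  shows "f (m + a mod N) = f (m + a)"
proof -
  have "f (m + k * N) = f m" for k m
  proof (induction k rule: int_induct[of _ 0])
    case (step1 k)
    then show ?case using assms[of "m + k * N"] by (simp add: algebra_simps)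
  next
    case (step2 k)
    then show ?case using assms[of "m + (k - 1) * N"] by (simp add: algebra_simps)
  qed simp
  from this[of "m + a mod N" "a div N"] show ?thesis
    by (simp add: add.assoc)
qed

lemma wreath_carrier:
  "(a, f) \<in> carrier (wreath N P) \<longleftrightarrow> a mod N = a \<and> (\<forall>m. f m \<in> carrier P) \<and> (\<forall>m. f (m + N) = f m)"
  by (auto simp: wreath_def)

lemma wreath_mult [simp]:
  "(a, f) \<otimes>\<^bsub>wreath N P\<^esub> (b, g) = ((a + b) mod N, \<lambda>m. f m \<otimes>\<^bsub>P\<^esub> g (m + a))"
  by (simp add: wreath_def)

lemma wreath_one [simp]: "\<one>\<^bsub>wreath N P\<^esub> = (0, \<lambda>m. \<one>\<^bsub>P\<^esub>)"
  by (simp add: wreath_def)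

context
  fixes P :: "('p, 'n) monoid_scheme" and N :: int
  assumes group_P: "group P"
begin

interpretation P: group P by (rule group_P)

lemma wreath_inverse:
  assumes "(a, f) \<in> carrier (wreath N P)"
  shows "((- a) mod N, \<lambda>m. inv\<^bsub>P\<^esub> f (m - a)) \<in> carrier (wreath N P)"
    "((- a) mod N, \<lambda>m. inv\<^bsub>P\<^esub> f (m - a)) \<otimes>\<^bsub>wreath N P\<^esub> (a, f) = \<one>\<^bsub>wreath N P\<^esub>"
proof -
  have f: "f m \<in> carrier P" "f (m + N) = f m" for m using assms by (auto simp: wreath_carrier)
  have "f (m + N - a) = f (m - a)" for m using f(2)[of "m - a"] by (simp add: algebra_simps)
  then show "((- a) mod N, \<lambda>m. inv\<^bsub>P\<^esub> f (m - a)) \<in> carrier (wreath N P)"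
    using f(1) by (simp add: wreath_carrier)
  show "((- a) mod N, \<lambda>m. inv\<^bsub>P\<^esub> f (m - a)) \<otimes>\<^bsub>wreath N P\<^esub> (a, f) = \<one>\<^bsub>wreath N P\<^esub>"
    using f(1) periodic_mod[of f N _ "- a", OF f(2)] by (simp add: mod_add_left_eq)
qed

lemma group_wreath: "group (wreath N P)"
proof (rule groupI)
  fix A B assume "A \<in> carrier (wreath N P)" "B \<in> carrier (wreath N P)"
  then obtain a f b g where A: "A = (a, f)" "(a, f) \<in> carrier (wreath N P)"
    and B: "B = (b, g)" "(b, g) \<in> carrier (wreath N P)" by (metis surj_pair)
  have "g (m + N + a) = g (m + a)" for m
    using B(2) by (metis wreath_carrier add.commute add.left_commute)
  then show "A \<otimes>\<^bsub>wreath N P\<^esub> B \<in> carrier (wreath N P)"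
    using A(2) B(2) by (simp add: A(1) B(1) wreath_carrier)
  fix C assume "C \<in> carrier (wreath N P)"
  then obtain c h where C: "C = (c, h)" "(c, h) \<in> carrier (wreath N P)" by (metis surj_pair)
  have "h (m + (a + b) mod N) = h (m + a + b)" for m
    using C(2) periodic_mod[of h N m "a + b"] by (simp add: wreath_carrier add.assoc)
  then show "A \<otimes>\<^bsub>wreath N P\<^esub> B \<otimes>\<^bsub>wreath N P\<^esub> C = A \<otimes>\<^bsub>wreath N P\<^esub> (B \<otimes>\<^bsub>wreath N P\<^esub> C)"
    using A(2) B(2) C(2) by (simp add: A(1) B(1) C(1) wreath_carrier P.m_assoc mod_simps add.assoc)
next
  show "\<one>\<^bsub>wreath N P\<^esub> \<in> carrier (wreath N P)" by (simp add: wreath_carrier)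
  fix A assume "A \<in> carrier (wreath N P)"
  then obtain a f where A: "A = (a, f)" "(a, f) \<in> carrier (wreath N P)" by (metis surj_pair)
  then show "\<one>\<^bsub>wreath N P\<^esub> \<otimes>\<^bsub>wreath N P\<^esub> A = A" by (simp add: wreath_carrier)
  show "\<exists>B\<in>carrier (wreath N P). B \<otimes>\<^bsub>wreath N P\<^esub> A = \<one>\<^bsub>wreath N P\<^esub>"
    unfolding A(1) using wreath_inverse[OF A(2)] by (rule bexI[rotated])
qed

lemma finite_wreath:
  assumes "0 < N" "finite (carrier P)"
  shows "finite (carrier (wreath N P))"
proof (rule finite_subset)
  let ?F = "(\<lambda>g m. g (m mod N)) ` (PiE {0..<N} (\<lambda>_. carrier P))"
  show "finite ({0..<N} \<times> ?F)" using assms(2) by (intro finite_cartesian_product finite_imageI finite_PiE) auto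
  show "carrier (wreath N P) \<subseteq> {0..<N} \<times> ?F"
  proof
    fix A assume "A \<in> carrier (wreath N P)"
    then obtain a f where A: "A = (a, f)" "(a, f) \<in> carrier (wreath N P)" by (metis surj_pair)
    then have f: "f m \<in> carrier P" "f (m + N) = f m" and a: "a mod N = a" for m
      by (auto simp: wreath_carrier)
    have "f m = restrict f {0..<N} (m mod N)" for m
      using periodic_mod[of f N 0 m, OF f(2)] assms(1) by simp
    moreover have "restrict f {0..<N} \<in> PiE {0..<N} (\<lambda>_. carrier P)" using f(1) by auto
    ultimately have "f \<in> ?F" by (intro image_eqI[of _ _ "restrict f {0..<N}"] ext)
    moreover have "a \<in> {0..<N}" using assms(1) pos_mod_bound[of N a] pos_mod_sign[of N a] by (simp add: a)
    ultimately show "A \<in> {0..<N} \<times> ?F" by (simp add: A(1))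
  qed
qed

text \<open>The first component follows the height, the second gives for each starting height
  \<open>m\<close> the value of the lifted path from \<open>m\<close>. The shift by \<open>a\<close>
  in the wreath multiplication is the height reached by the first factor.\<close>

lemma word_value_wreath:
  fixes H :: "('h, 'm) monoid_scheme" and \<theta> :: "'x \<Rightarrow> int"
  assumes i: "interp H P \<rho> q" and periodic: "\<And>m x. q (m + N, x) = q (m, x)"
  defines "\<rho>' \<equiv> \<lambda>h. (0, \<lambda>m. \<rho> h)"
    and "q' \<equiv> \<lambda>x. (\<theta> x mod N, \<lambda>m. q (min m (m + \<theta> x), x))"
  shows "interp H (wreath N P) \<rho>' q'"
    and "coeffs w \<subseteq> carrier H \<Longrightarrow>
      word_value (wreath N P) \<rho>' q' w = (weight \<theta> w mod N, \<lambda>m. word_value P \<rho> q (lift \<theta> m w))"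
proof -
  interpret W: group "wreath N P" by (rule group_wreath)
  interpret \<rho>: group_hom H P \<rho>
    using interpD[OF i] by (simp add: group_hom_def group_hom_axioms_def)
  have q'_in: "q' x \<in> carrier (wreath N P)" for x
  proof -
    have "q (min (m + N) (m + N + \<theta> x), x) = q (min m (m + \<theta> x), x)" for m
    proof -
      have "min (m + N) (m + N + \<theta> x) = min m (m + \<theta> x) + N" by (simp add: min_def)
      then show ?thesis using periodic by simp
    qed
    then show ?thesis using interpD(4)[OF i] by (simp add: q'_def wreath_carrier)
  qed
  have \<rho>'_in: "\<rho>' h \<in> carrier (wreath N P)" if "h \<in> carrier H" for h
    using that by (simp add: \<rho>'_def wreath_carrier)
  have "\<rho>' \<in> hom H (wreath N P)"
    using \<rho>'_in by (auto intro!: homI simp: \<rho>'_def)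
  then show interp': "interp H (wreath N P) \<rho>' q'"
    unfolding interp_def using q'_in interpD(1)[OF i] W.is_group by auto
  \<comment> \<open>An inverse letter started at \<open>m\<close> leads to
    \<open>m - \<theta> x\<close>, so it traverses the edge whose lower end is the smaller of these
    two heights.\<close>
  have inv_q': "inv\<^bsub>wreath N P\<^esub> q' x = ((- \<theta> x) mod N, \<lambda>m. inv\<^bsub>P\<^esub> q (min m (m - \<theta> x), x))" for x
  proof -
    define f where "f m = q (min m (m + \<theta> x), x)" for m
    have q': "q' x = (\<theta> x mod N, f)" by (simp add: q'_def f_def[abs_def])
    have per: "f (m + N) = f m" for m using q'_in[of x] by (simp add: q' wreath_carrier)
    have "inv\<^bsub>wreath N P\<^esub> q' x = ((- (\<theta> x mod N)) mod N, \<lambda>m. inv\<^bsub>P\<^esub> f (m - \<theta> x mod N))"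
      using wreath_inverse[of "\<theta> x mod N" f] q'_in[of x] by (intro W.inv_equality) (simp_all add: q')
    moreover have "f (m - \<theta> x mod N) = f (m - \<theta> x)" for m
      using periodic_mod[of f N "m - \<theta> x - \<theta> x mod N" "\<theta> x", OF per] by simp
    ultimately show ?thesis by (simp add: f_def mod_minus_eq min.commute)
  qed
  show "word_value (wreath N P) \<rho>' q' w = (weight \<theta> w mod N, \<lambda>m. word_value P \<rho> q (lift \<theta> m w))"
    if "coeffs w \<subseteq> carrier H" using that
  proof (induction w rule: word_induct)
    case (Inr x b w)
    let ?f = "\<lambda>m. word_value P \<rho> q (lift \<theta> m w)"
    have "word_value (wreath N P) \<rho>' q' w \<in> carrier (wreath N P)"
      using word_value_closed[OF interp'] Inr.prems by simp
    then have "?f (m + N) = ?f m" for m using Inr by (simp add: wreath_carrier)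
    then have "?f (m + a mod N) = ?f (m + a)" for m a by (rule periodic_mod)
    then show ?case
      using Inr by (cases b) (simp_all add: inv_q', simp_all add: q'_def mod_simps)
  qed (auto simp: \<rho>'_def)
qed

end

section \<open>The universal property of a relative presentation\<close>

lemma normal_closure_normal:
  assumes "group G" "S \<subseteq> carrier G"
  shows "normal_closure G S \<lhd> G" "S \<subseteq> normal_closure G S"
proof -
  interpret G: group G by fact
  let ?A = "{N. N \<lhd> G \<and> S \<subseteq> N}"
  have "carrier G \<in> ?A" using assms(2) G.normal_invI[OF G.subgroup_self] by auto
  then have "subgroup (\<Inter>?A) G"
    by (intro G.subgroups_Inter) (auto dest: normal_imp_subgroup)
  then show "normal_closure G S \<lhd> G"
    unfolding normal_closure_def by (rule G.normal_invI) (auto dest: normal.inv_op_closed2)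
qed (auto simp: normal_closure_def)

fun list_value :: "('p, 'n) monoid_scheme \<Rightarrow> ('a \<Rightarrow> 'p) \<Rightarrow> 'a list \<Rightarrow> 'p" where
  "list_value P f [] = \<one>\<^bsub>P\<^esub>"
| "list_value P f (a # w) = f a \<otimes>\<^bsub>P\<^esub> list_value P f w"

lemma presented_monoid_hom:
  assumes "group P" and f: "f \<in> A \<rightarrow> carrier P"
    and rels: "\<And>u v. (u, v) \<in> S \<Longrightarrow> u \<in> lists A \<Longrightarrow> v \<in> lists A \<Longrightarrow> list_value P f u = list_value P f v"
  obtains \<Phi> where "\<Phi> \<in> hom (presented_monoid A S) P"
    "\<And>w. w \<in> lists A \<Longrightarrow> \<Phi> (word_cong A S `` {w}) = list_value P f w"
proof -
  interpret P: group P by fact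
  have closed: "list_value P f w \<in> carrier P" if "w \<in> lists A" for w
    using that by induction (use f in auto)
  have append: "list_value P f (u @ v) = list_value P f u \<otimes>\<^bsub>P\<^esub> list_value P f v"
    if "u \<in> lists A" "v \<in> lists A" for u v
    using that(1)
  proof induction
    case (Cons a u)
    then show ?case using f closed[OF Cons.hyps(2)] closed[OF that(2)] by (simp add: P.m_assoc Pi_iff)
  qed (use closed[OF that(2)] in simp)
  have cong: "list_value P f u = list_value P f v" if "(u, v) \<in> word_cong A S" for u v
    using that
  proof induction
    case (step u v p q)
    then show ?case using rels by (simp add: append)
  qed auto
  define \<Phi> where "\<Phi> C = list_value P f (SOME w. w \<in> C)" for C
  have \<Phi>: "\<Phi> (word_cong A S `` {w}) = list_value P f w" if "w \<in> lists A" for w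
  proof -
    have "\<exists>v. v \<in> word_cong A S `` {w}" using that word_cong.refl by fast
    then have "(SOME v. v \<in> word_cong A S `` {w}) \<in> word_cong A S `` {w}" by (rule someI_ex)
    then show ?thesis unfolding \<Phi>_def using cong by fastforce
  qed
  have "\<Phi> \<in> hom (presented_monoid A S) P"
  proof (rule homI)
    fix C D assume "C \<in> carrier (presented_monoid A S)" "D \<in> carrier (presented_monoid A S)"
    then obtain u v where *: "u \<in> lists A" "v \<in> lists A" "C = word_cong A S `` {u}" "D = word_cong A S `` {v}"
      unfolding presented_monoid_carrier_iff by blast
    then have "u @ v \<in> lists A" by simp
    then show "\<Phi> (C \<otimes>\<^bsub>presented_monoid A S\<^esub> D) = \<Phi> C \<otimes>\<^bsub>P\<^esub> \<Phi> D"
      unfolding *(3,4) presented_monoid_mult[OF *(1,2)] by (simp only: \<Phi> append * )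
  next
    fix C assume "C \<in> carrier (presented_monoid A S)"
    then obtain u where "u \<in> lists A" "C = word_cong A S `` {u}"
      unfolding presented_monoid_carrier_iff by blast
    then show "\<Phi> C \<in> carrier P" using \<Phi> closed by metis
  qed
  then show thesis using \<Phi> by (rule that)
qed

section \<open>Homomorphisms from free groups and free products\<close>

abbreviation "inverse_pairs V \<equiv> {([(x, b), (x, \<not> b)], []) | x b. x \<in> V}"

lemma free_gen_closed: "x \<in> V \<Longrightarrow> free_gen V x \<in> carrier (free_group V)"
  unfolding free_gen_def free_group_def presented_monoid_carrier_iff
  by (rule bexI[of _ "[(x, True)]"]) auto

lemma free_gen_inverse:
  assumes "x \<in> V"
  shows "inv\<^bsub>free_group V\<^esub> free_gen V x = word_cong (V \<times> UNIV) (inverse_pairs V) `` {[(x, False)]}"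
proof (rule group.inv_equality[OF group_free_group])
  have l: "[(x, b)] \<in> lists (V \<times> UNIV)" "[] \<in> lists (V \<times> UNIV)" for b using assms by auto
  have "([] @ [(x, False), (x, True)] @ [], [] @ [] @ []) \<in> word_cong (V \<times> UNIV) (inverse_pairs V)"
    by (rule word_cong.step) (use assms in force)+
  then have "word_cong (V \<times> UNIV) (inverse_pairs V) `` {[(x, False), (x, True)]}
      = word_cong (V \<times> UNIV) (inverse_pairs V) `` {[]}"
    by (intro equiv_class_eq[OF equiv_word_cong]) simp
  then show "word_cong (V \<times> UNIV) (inverse_pairs V) `` {[(x, False)]} \<otimes>\<^bsub>free_group V\<^esub> free_gen V x
      = \<one>\<^bsub>free_group V\<^esub>"
    unfolding free_group_def free_gen_def presented_monoid_one presented_monoid_mult[OF l(1) l(1)]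
    by simp
  show "word_cong (V \<times> UNIV) (inverse_pairs V) `` {[(x, False)]} \<in> carrier (free_group V)"
    unfolding free_group_def presented_monoid_carrier_iff using HOL.refl l(1) by (rule bexI)
qed (rule free_gen_closed[OF assms])

lemma free_group_hom:
  assumes "group P" "\<And>x. x \<in> V \<Longrightarrow> p x \<in> carrier P"
  obtains \<phi> where "\<phi> \<in> hom (free_group V) P" "\<And>x. x \<in> V \<Longrightarrow> \<phi> (free_gen V x) = p x"
proof -
  interpret P: group P by fact
  let ?f = "\<lambda>(x, b). if b then p x else inv\<^bsub>P\<^esub> p x"
  obtain \<phi> where \<phi>: "\<phi> \<in> hom (presented_monoid (V \<times> UNIV) (inverse_pairs V)) P"
    "\<And>w. w \<in> lists (V \<times> UNIV) \<Longrightarrow> \<phi> (word_cong (V \<times> UNIV) (inverse_pairs V) `` {w}) = list_value P ?f w"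
    by (rule presented_monoid_hom[of P ?f "V \<times> UNIV" "inverse_pairs V"])
      (use assms in \<open>auto split: if_splits\<close>)
  have "\<phi> (free_gen V x) = p x" if "x \<in> V" for x
    unfolding free_gen_def using that assms(2) by (subst \<phi>(2)) auto
  then show thesis using \<phi>(1) that unfolding free_group_def by blast
qed

context
  fixes G :: "('a, 'm) monoid_scheme" and K :: "('b, 'n) monoid_scheme"
  assumes G: "group G" and K: "group K"
begin

interpretation G: group G by (rule G)
interpretation K: group K by (rule K)

abbreviation (input) "fp_letters \<equiv> Inl ` carrier G \<union> Inr ` carrier K"
abbreviation (input) "fp_class w \<equiv> word_cong fp_letters (free_product_rels G K) `` {w}"

lemma fp_class_in: "w \<in> lists fp_letters \<Longrightarrow> fp_class w \<in> carrier (free_product G K)"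
  unfolding free_product_def presented_monoid_carrier_iff by blast

lemma fp_class_append:
  "u \<in> lists fp_letters \<Longrightarrow> v \<in> lists fp_letters \<Longrightarrow>
    fp_class u \<otimes>\<^bsub>free_product G K\<^esub> fp_class v = fp_class (u @ v)"
  unfolding free_product_def by (rule presented_monoid_mult)

lemma fp_class_rel:
  assumes "(u, v) \<in> free_product_rels G K" "u \<in> lists fp_letters" "v \<in> lists fp_letters"
  shows "fp_class u = fp_class v"
  using word_cong.step[OF assms, of "[]" "[]"] by (intro equiv_class_eq[OF equiv_word_cong]) simp

lemma free_product_inl_hom: "free_product_inl G K \<in> hom G (free_product G K)"
proof (rule homI)
  fix a b assume *: "a \<in> carrier G" "b \<in> carrier G"
  have "fp_class [Inl a, Inl b] = fp_class [Inl (a \<otimes>\<^bsub>G\<^esub> b)]"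
    by (rule fp_class_rel) (use * in \<open>auto simp: free_product_rels_def\<close>)
  then show "free_product_inl G K (a \<otimes>\<^bsub>G\<^esub> b) =
      free_product_inl G K a \<otimes>\<^bsub>free_product G K\<^esub> free_product_inl G K b"
    unfolding free_product_inl_def using * by (subst fp_class_append) auto
next
  fix a assume "a \<in> carrier G"
  then show "free_product_inl G K a \<in> carrier (free_product G K)"
    unfolding free_product_inl_def by (intro fp_class_in) simp
qed

lemma free_product_inr_hom: "free_product_inr G K \<in> hom K (free_product G K)"
proof (rule homI)
  fix a b assume *: "a \<in> carrier K" "b \<in> carrier K"
  have "fp_class [Inr a, Inr b] = fp_class [Inr (a \<otimes>\<^bsub>K\<^esub> b)]"
    by (rule fp_class_rel) (use * in \<open>auto simp: free_product_rels_def\<close>)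
  then show "free_product_inr G K (a \<otimes>\<^bsub>K\<^esub> b) =
      free_product_inr G K a \<otimes>\<^bsub>free_product G K\<^esub> free_product_inr G K b"
    unfolding free_product_inr_def using * by (subst fp_class_append) auto
next
  fix a assume "a \<in> carrier K"
  then show "free_product_inr G K a \<in> carrier (free_product G K)"
    unfolding free_product_inr_def by (intro fp_class_in) simp
qed

lemma free_product_hom:
  assumes "group P" "\<phi> \<in> hom G P" "\<psi> \<in> hom K P"
  obtains \<Phi> where "\<Phi> \<in> hom (free_product G K) P"
    "\<And>a. a \<in> carrier G \<Longrightarrow> \<Phi> (free_product_inl G K a) = \<phi> a"
    "\<And>b. b \<in> carrier K \<Longrightarrow> \<Phi> (free_product_inr G K b) = \<psi> b"
proof -
  interpret P: group P by fact
  interpret \<phi>: group_hom G P \<phi> using assms G by (simp add: group_hom_def group_hom_axioms_def)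
  interpret \<psi>: group_hom K P \<psi> using assms K by (simp add: group_hom_def group_hom_axioms_def)
  let ?f = "case_sum \<phi> \<psi>"
  have rel: "list_value P ?f u = list_value P ?f v" if "(u, v) \<in> free_product_rels G K" for u v
    using that by (auto simp: free_product_rels_def)
  have f: "?f \<in> fp_letters \<rightarrow> carrier P" by auto
  obtain \<Phi> where \<Phi>: "\<Phi> \<in> hom (presented_monoid fp_letters (free_product_rels G K)) P"
    "\<And>w. w \<in> lists fp_letters \<Longrightarrow> \<Phi> (fp_class w) = list_value P ?f w"
    by (rule presented_monoid_hom[OF assms(1) f rel]) auto
  have "\<Phi> (free_product_inl G K a) = \<phi> a" if "a \<in> carrier G" for a
    unfolding free_product_inl_def using that by (subst \<Phi>(2)) auto
  moreover have "\<Phi> (free_product_inr G K b) = \<psi> b" if "b \<in> carrier K" for b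
    unfolding free_product_inr_def using that by (subst \<Phi>(2)) auto
  ultimately show thesis using \<Phi>(1) that unfolding free_product_def by blast
qed

lemma free_product_induct:
  assumes "g \<in> carrier (free_product G K)" "Q \<one>\<^bsub>free_product G K\<^esub>"
    "\<And>a g. a \<in> carrier G \<Longrightarrow> g \<in> carrier (free_product G K) \<Longrightarrow> Q g
      \<Longrightarrow> Q (free_product_inl G K a \<otimes>\<^bsub>free_product G K\<^esub> g)"
    "\<And>b g. b \<in> carrier K \<Longrightarrow> g \<in> carrier (free_product G K) \<Longrightarrow> Q g
      \<Longrightarrow> Q (free_product_inr G K b \<otimes>\<^bsub>free_product G K\<^esub> g)"
  shows "Q g"
proof -
  have "Q (fp_class w)" if "w \<in> lists fp_letters" for w
    using that
  proof induction
    case Nil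
    then show ?case using assms(2) by (simp add: free_product_def presented_monoid_one)
  next
    case (Cons a w)
    from Cons.hyps(1) have l: "[a] \<in> lists fp_letters" by simp
    have "fp_class (a # w) = fp_class [a] \<otimes>\<^bsub>free_product G K\<^esub> fp_class w"
      using fp_class_append[OF l Cons.hyps(2)] by simp
    then show ?case
      using Cons assms(3,4) fp_class_in[OF Cons.hyps(2)]
      unfolding free_product_inl_def free_product_inr_def by (elim UnE imageE) simp_all
  qed
  then show ?thesis
    using assms(1) unfolding free_product_def presented_monoid_carrier_iff by blast
qed

end

lemma free_group_induct:
  assumes "g \<in> carrier (free_group V)" "Q \<one>\<^bsub>free_group V\<^esub>"
    "\<And>x g. x \<in> V \<Longrightarrow> g \<in> carrier (free_group V) \<Longrightarrow> Q g \<Longrightarrow> Q (free_gen V x \<otimes>\<^bsub>free_group V\<^esub> g)"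
    "\<And>x g. x \<in> V \<Longrightarrow> g \<in> carrier (free_group V) \<Longrightarrow> Q g
      \<Longrightarrow> Q (inv\<^bsub>free_group V\<^esub> free_gen V x \<otimes>\<^bsub>free_group V\<^esub> g)"
  shows "Q g"
proof -
  let ?c = "\<lambda>w. word_cong (V \<times> UNIV) (inverse_pairs V) `` {w}"
  have "Q (?c w)" if "w \<in> lists (V \<times> UNIV)" for w
    using that
  proof induction
    case Nil
    then show ?case using assms(2) by (simp add: free_group_def presented_monoid_one)
  next
    case (Cons a w)
    obtain x b where a: "a = (x, b)" "x \<in> V" using Cons.hyps(1) by auto
    have l: "[a] \<in> lists (V \<times> UNIV)" using Cons.hyps(1) by simp
    have w: "?c w \<in> carrier (free_group V)"
      unfolding free_group_def presented_monoid_carrier_iff using Cons.hyps(2) by blast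
    have "?c (a # w) = ?c [a] \<otimes>\<^bsub>free_group V\<^esub> ?c w"
      unfolding free_group_def using presented_monoid_mult[OF l Cons.hyps(2), of "inverse_pairs V"] by simp
    also have "?c [a] = (if b then free_gen V x else inv\<^bsub>free_group V\<^esub> free_gen V x)"
      using a free_gen_inverse[OF a(2)] by (simp add: free_gen_def)
    finally show ?case using assms(3,4)[OF a(2) w Cons.IH] by simp
  qed
  then show ?thesis
    using assms(1) unfolding free_group_def presented_monoid_carrier_iff by blast
qed

definition relator_word :: "('x, 'h) rel_expr \<Rightarrow> ('h + 'x \<times> bool) list" where
  "relator_word R = concat (map (\<lambda>(x, \<epsilon>, h). [Inr (x, \<epsilon> = 1), Inl h]) R)"

text \<open>The junk value outside \<open>V\<close> makes this a total map into the group.\<close>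

definition rel_gen :: "'x set \<Rightarrow> ('h, 'm) monoid_scheme \<Rightarrow> ('x, 'h) rel_expr
      \<Rightarrow> 'x \<Rightarrow> ('h + ('x \<times> bool) list set) list set set" where
  "rel_gen V H R x = (if x \<in> V then
     normal_closure (rel_free_product V H) {relator V H R}
       #>\<^bsub>rel_free_product V H\<^esub> free_product_inr H (free_group V) (free_gen V x)
     else \<one>\<^bsub>rel_group V H R\<^esub>)"

section \<open>The presented group, its elements as words, and maps out of it\<close>

locale rel_pres =
  fixes V :: "'x set" and H :: "('h, 'm) monoid_scheme" and R :: "('x, 'h) rel_expr"
  assumes pres: "relative_presentation V H R"
begin

abbreviation "FP \<equiv> rel_free_product V H"
abbreviation "FG \<equiv> free_group V"
abbreviation "G \<equiv> rel_group V H R"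
abbreviation "inl \<equiv> free_product_inl H FG"
abbreviation "inr \<equiv> free_product_inr H FG"
abbreviation "NC \<equiv> normal_closure FP {relator V H R}"

lemma group_H: "group H"
  using pres by (simp add: relative_presentation_def)

sublocale FG: group FG by (rule group_free_group)
sublocale FP: group FP by (rule group_free_product[OF group_H group_free_group])

definition fp_gen :: "'x \<Rightarrow> ('h + ('x \<times> bool) list set) list set" where
  "fp_gen x = (if x \<in> V then inr (free_gen V x) else \<one>\<^bsub>FP\<^esub>)"

lemma inr_hom: "inr \<in> hom FG FP" and inl_hom: "inl \<in> hom H FP"
  using free_product_inr_hom free_product_inl_hom group_H group_free_group by blast+

sublocale inr: group_hom FG FP inr
  using inr_hom by unfold_locales

lemma interp_FP: "interp H FP inl fp_gen"
  unfolding interp_def using group_H FP.is_group inl_hom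
  by (auto simp: fp_gen_def free_gen_closed)

lemma coeffs_relator_word: "coeffs (relator_word R) \<subseteq> carrier H"
  and edges_relator_word: "edges (relator_word R) \<subseteq> V"
  using pres by (auto simp: relative_presentation_def relator_word_def coeffs_def edges_def)

lemma relator_eq: "relator V H R = word_value FP inl fp_gen (relator_word R)"
proof -
  have "\<forall>(x, \<epsilon>, h)\<in>set R. x \<in> V \<and> \<epsilon> \<in> {1, -1} \<and> h \<in> carrier H"
    using pres by (simp add: relative_presentation_def)
  then show ?thesis
  proof (induction R)
    case Nil
    then show ?case by (simp add: relator_word_def)
  next
    case (Cons a R)
    obtain x \<epsilon> h where a: "a = (x, \<epsilon>, h)" by (cases a)
    have x: "x \<in> V" and \<epsilon>: "\<epsilon> = 1 \<or> \<epsilon> = -1" using Cons.prems by (auto simp: a)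
    have "inr (free_gen V x [^]\<^bsub>FG\<^esub> \<epsilon>) = (if \<epsilon> = 1 then fp_gen x else inv\<^bsub>FP\<^esub> fp_gen x)"
      using \<epsilon> x free_gen_closed[OF x] by (auto simp: fp_gen_def FG.int_pow_neg)
    then show ?case using Cons by (simp add: a relator_word_def)
  qed
qed

lemma relator_closed: "relator V H R \<in> carrier FP"
  unfolding relator_eq using interp_FP coeffs_relator_word by (rule word_value_closed)

lemma NC_normal: "NC \<lhd> FP" and relator_in_NC: "relator V H R \<in> NC"
  using normal_closure_normal[OF FP.is_group, of "{relator V H R}"] relator_closed by auto

sublocale G: group G
  unfolding rel_group_def using NC_normal by (rule normal.factorgroup_is_group)

lemma quotient_hom: "(\<lambda>a. NC #>\<^bsub>FP\<^esub> a) \<in> hom FP G"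
  unfolding rel_group_def using NC_normal by (rule normal.r_coset_hom_Mod)

lemma natural_hom_hom: "natural_hom V H R \<in> hom H G"
  using hom_compose[OF inl_hom quotient_hom] by (simp add: natural_hom_def[abs_def] comp_def)

lemma rel_gen_eq: "rel_gen V H R = (\<lambda>x. NC #>\<^bsub>FP\<^esub> fp_gen x)"
  using NC_normal
  by (auto simp: fun_eq_iff rel_gen_def fp_gen_def rel_group_def normal_imp_subgroup subgroup.subset)

lemma interp_G: "interp H G (natural_hom V H R) (rel_gen V H R)"
  unfolding interp_def using group_H G.is_group natural_hom_hom interpD(4)[OF interp_FP]
    hom_in_carrier[OF quotient_hom] by (auto simp: rel_gen_eq)

lemma quotient_word_value:
  "coeffs w \<subseteq> carrier H \<Longrightarrow>
    NC #>\<^bsub>FP\<^esub> word_value FP inl fp_gen w = word_value G (natural_hom V H R) (rel_gen V H R) w"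
  using word_value_hom[OF interp_FP _ G.is_group quotient_hom, of w]
  by (simp add: natural_hom_def[abs_def] rel_gen_eq)

lemma relator_word_trivial: "word_value G (natural_hom V H R) (rel_gen V H R) (relator_word R) = \<one>\<^bsub>G\<^esub>"
proof -
  have "NC #>\<^bsub>FP\<^esub> relator V H R = NC"
    using relator_in_NC NC_normal by (simp add: FP.coset_join2 normal_imp_subgroup relator_closed)
  then show ?thesis
    using quotient_word_value[OF coeffs_relator_word] by (simp add: relator_eq rel_group_def)
qed

lemma ex_word_FP:
  assumes "g \<in> carrier FP"
  shows "\<exists>w. coeffs w \<subseteq> carrier H \<and> edges w \<subseteq> V \<and> word_value FP inl fp_gen w = g"
proof (rule free_product_induct[OF group_H group_free_group assms])
  show "\<exists>w. coeffs w \<subseteq> carrier H \<and> edges w \<subseteq> V \<and> word_value FP inl fp_gen w = \<one>\<^bsub>FP\<^esub>"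
    by (rule exI[of _ "[]"]) simp
next
  fix a g assume "a \<in> carrier H" "\<exists>w. coeffs w \<subseteq> carrier H \<and> edges w \<subseteq> V \<and> word_value FP inl fp_gen w = g"
  then obtain w where "coeffs w \<subseteq> carrier H" "edges w \<subseteq> V" "word_value FP inl fp_gen w = g" by blast
  with \<open>a \<in> carrier H\<close>
  show "\<exists>w. coeffs w \<subseteq> carrier H \<and> edges w \<subseteq> V \<and> word_value FP inl fp_gen w = inl a \<otimes>\<^bsub>FP\<^esub> g"
    by (intro exI[of _ "Inl a # w"]) auto
next
  fix b g assume b: "b \<in> carrier FG" and g: "g \<in> carrier FP"
    "\<exists>w. coeffs w \<subseteq> carrier H \<and> edges w \<subseteq> V \<and> word_value FP inl fp_gen w = g"
  show "\<exists>w. coeffs w \<subseteq> carrier H \<and> edges w \<subseteq> V \<and> word_value FP inl fp_gen w = inr b \<otimes>\<^bsub>FP\<^esub> g"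
  proof (rule free_group_induct[OF b])
    show "\<exists>w. coeffs w \<subseteq> carrier H \<and> edges w \<subseteq> V \<and> word_value FP inl fp_gen w = inr \<one>\<^bsub>FG\<^esub> \<otimes>\<^bsub>FP\<^esub> g"
      using g by simp
  next
    fix x c assume x: "x \<in> V" and c: "c \<in> carrier FG"
      and "\<exists>w. coeffs w \<subseteq> carrier H \<and> edges w \<subseteq> V \<and> word_value FP inl fp_gen w = inr c \<otimes>\<^bsub>FP\<^esub> g"
    then obtain w where w: "coeffs w \<subseteq> carrier H" "edges w \<subseteq> V"
      "word_value FP inl fp_gen w = inr c \<otimes>\<^bsub>FP\<^esub> g" by blast
    show "\<exists>w. coeffs w \<subseteq> carrier H \<and> edges w \<subseteq> V \<and>
        word_value FP inl fp_gen w = inr (free_gen V x \<otimes>\<^bsub>FG\<^esub> c) \<otimes>\<^bsub>FP\<^esub> g"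
      using x c g(1) w free_gen_closed[OF x]
      by (intro exI[of _ "Inr (x, True) # w"]) (auto simp: fp_gen_def FP.m_assoc)
    show "\<exists>w. coeffs w \<subseteq> carrier H \<and> edges w \<subseteq> V \<and>
        word_value FP inl fp_gen w = inr (inv\<^bsub>FG\<^esub> free_gen V x \<otimes>\<^bsub>FG\<^esub> c) \<otimes>\<^bsub>FP\<^esub> g"
      using x c g(1) w free_gen_closed[OF x]
      by (intro exI[of _ "Inr (x, False) # w"]) (auto simp: fp_gen_def FP.m_assoc)
  qed
qed

lemma ex_word_G:
  assumes "g \<in> carrier G"
  obtains w where "coeffs w \<subseteq> carrier H" "edges w \<subseteq> V"
    "word_value G (natural_hom V H R) (rel_gen V H R) w = g"
proof -
  obtain a where a: "a \<in> carrier FP" "g = NC #>\<^bsub>FP\<^esub> a"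
    using assms by (auto simp: rel_group_def carrier_FactGroup)
  then obtain w where "coeffs w \<subseteq> carrier H" "edges w \<subseteq> V" "word_value FP inl fp_gen w = a"
    using ex_word_FP by blast
  then show thesis using that quotient_word_value[of w] a by simp
qed

text \<open>Phrased with words so that it applies directly to lifted paths. The restriction to
  letters in \<open>V\<close> reflects that \<open>rel_gen\<close> is trivial elsewhere, while
  \<open>p\<close> is arbitrary there.\<close>

lemma rel_group_hom:
  assumes "interp H P \<rho> p" "word_value P \<rho> p (relator_word R) = \<one>\<^bsub>P\<^esub>"
  obtains \<Phi> where "\<Phi> \<in> hom G P"
    "\<And>w. coeffs w \<subseteq> carrier H \<Longrightarrow> edges w \<subseteq> V \<Longrightarrow>
      \<Phi> (word_value G (natural_hom V H R) (rel_gen V H R) w) = word_value P \<rho> p w"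
proof -
  interpret P: group P using assms(1) by (rule interpD)
  obtain \<psi> where \<psi>: "\<psi> \<in> hom FG P" "\<And>x. x \<in> V \<Longrightarrow> \<psi> (free_gen V x) = p x"
    using free_group_hom[OF P.is_group, of V p] interpD(4)[OF assms(1)] by blast
  obtain \<Phi> where \<Phi>: "\<Phi> \<in> hom FP P" "\<And>h. h \<in> carrier H \<Longrightarrow> \<Phi> (inl h) = \<rho> h"
    "\<And>c. c \<in> carrier FG \<Longrightarrow> \<Phi> (inr c) = \<psi> c"
    using free_product_hom[OF group_H group_free_group P.is_group interpD(3)[OF assms(1)] \<psi>(1)] by blast
  interpret \<Phi>: group_hom FP P \<Phi>
    using \<Phi>(1) by unfold_locales
  have val: "\<Phi> (word_value FP inl fp_gen w) = word_value P \<rho> p w"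
    if "coeffs w \<subseteq> carrier H" "edges w \<subseteq> V" for w
    unfolding word_value_hom[OF interp_FP that(1) P.is_group \<Phi>(1)]
  proof (rule word_value_cong)
    fix x assume "x \<in> edges w"
    then have "x \<in> V" using that(2) by blast
    then show "\<Phi> (fp_gen x) = p x"
      using \<Phi>(3)[OF free_gen_closed] \<psi>(2) by (simp add: fp_gen_def)
  qed (use that(1) \<Phi>(2) in blast)
  have "\<Phi> (relator V H R) = \<one>\<^bsub>P\<^esub>"
    unfolding relator_eq using assms(2) val[OF coeffs_relator_word edges_relator_word] by simp
  then have "{relator V H R} \<subseteq> kernel FP P \<Phi>"
    using relator_closed by (simp add: kernel_def)
  then have "NC \<subseteq> kernel FP P \<Phi>"
    unfolding normal_closure_def using \<Phi>.normal_kernel by blast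
  from \<Phi>.FactGroup_universal_kernel[OF NC_normal this]
  obtain \<Psi> where \<Psi>: "\<Psi> \<in> hom G P" "\<And>a. a \<in> carrier FP \<Longrightarrow> \<Psi> (NC #>\<^bsub>FP\<^esub> a) = \<Phi> a"
    unfolding rel_group_def by blast
  show thesis
  proof (rule that[OF \<Psi>(1)])
    fix w :: "('h + 'x \<times> bool) list" assume w: "coeffs w \<subseteq> carrier H" "edges w \<subseteq> V"
    show "\<Psi> (word_value G (natural_hom V H R) (rel_gen V H R) w) = word_value P \<rho> p w"
      using \<Psi>(2)[OF word_value_closed[OF interp_FP w(1)]] val[OF w]
      by (simp add: quotient_word_value[OF w(1)])
  qed
qed

end

section \<open>Criteria for residual finiteness\<close>

lemma residually_finiteI:
  assumes "group G"
    and "\<And>g. g \<in> carrier G \<Longrightarrow> g \<noteq> \<one>\<^bsub>G\<^esub> \<Longrightarrow>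
      \<exists>(P :: 'p monoid) \<Phi>. group P \<and> finite (carrier P) \<and> \<Phi> \<in> hom G P \<and> \<Phi> g \<noteq> \<one>\<^bsub>P\<^esub>"
  shows "residually_finite G"
  unfolding residually_finite_def
proof (intro ballI impI)
  fix g assume "g \<in> carrier G" "g \<noteq> \<one>\<^bsub>G\<^esub>"
  then obtain P :: "'p monoid" and \<Phi> where P: "group P" "finite (carrier P)" "\<Phi> \<in> hom G P" "\<Phi> g \<noteq> \<one>\<^bsub>P\<^esub>"
    using assms(2) by blast
  interpret \<Phi>: group_hom G P \<Phi>
    using assms(1) P by (simp add: group_hom_def group_hom_axioms_def)
  let ?N = "kernel G P \<Phi>"
  have "inj_on (\<lambda>X. the_elem (\<Phi> ` X)) (rcosets\<^bsub>G\<^esub> ?N)"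
    using \<Phi>.FactGroup_inj_on by (simp add: FactGroup_def)
  moreover have "(\<lambda>X. the_elem (\<Phi> ` X)) ` (rcosets\<^bsub>G\<^esub> ?N) \<subseteq> carrier P"
    using \<Phi>.FactGroup_the_elem_mem by (auto simp: FactGroup_def)
  ultimately have "finite (rcosets\<^bsub>G\<^esub> ?N)"
    using P(2) by (meson finite_imageD finite_subset)
  then show "\<exists>N. N \<lhd> G \<and> finite (rcosets\<^bsub>G\<^esub> N) \<and> g \<notin> N"
    using \<Phi>.normal_kernel P(4) by (intro exI[of _ ?N]) (auto simp: kernel_def)
qed

text \<open>Composing the embedding with a finite quotient of \<open>G\<close> that keeps the image
  of \<open>g\<close> detects \<open>g\<close>.\<close>

lemma residually_finite_inj_hom:
  assumes "group G" "group K" "\<Phi> \<in> hom K G" "inj_on \<Phi> (carrier K)" "residually_finite G"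
  shows "residually_finite K"
proof (rule residually_finiteI[OF assms(2)])
  interpret \<Phi>: group_hom K G \<Phi>
    using assms by (simp add: group_hom_def group_hom_axioms_def)
  fix g assume g: "g \<in> carrier K" "g \<noteq> \<one>\<^bsub>K\<^esub>"
  then have "\<Phi> g \<noteq> \<one>\<^bsub>G\<^esub>" using assms(4) \<Phi>.hom_one by (metis \<Phi>.G.one_closed inj_onD)
  then obtain N where N: "N \<lhd> G" "finite (rcosets\<^bsub>G\<^esub> N)" "\<Phi> g \<notin> N"
    using assms(5) \<Phi>.hom_closed[OF g(1)] unfolding residually_finite_def by blast
  have "group (G Mod N)" using N(1) by (rule normal.factorgroup_is_group)
  moreover have "(\<lambda>a. N #>\<^bsub>G\<^esub> \<Phi> a) \<in> hom K (G Mod N)"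
    using hom_compose[OF assms(3) normal.r_coset_hom_Mod[OF N(1)]] by (simp add: comp_def)
  moreover have "N #>\<^bsub>G\<^esub> \<Phi> g \<noteq> \<one>\<^bsub>G Mod N\<^esub>"
  proof
    assume "N #>\<^bsub>G\<^esub> \<Phi> g = \<one>\<^bsub>G Mod N\<^esub>"
    then show False
      using \<Phi>.H.rcos_self[of "\<Phi> g" N] g(1) N(1,3) by (simp add: normal_imp_subgroup)
  qed
  moreover have "finite (carrier (G Mod N))" using N(2) by (simp add: FactGroup_def)
  ultimately show "\<exists>(P :: 'a set monoid) \<Psi>. group P \<and> finite (carrier P) \<and> \<Psi> \<in> hom K P \<and> \<Psi> g \<noteq> \<one>\<^bsub>P\<^esub>"
    by (intro exI[of _ "G Mod N"] exI[of _ "\<lambda>a. N #>\<^bsub>G\<^esub> \<Phi> a"]) simp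
qed

section \<open>Relators with the unique max-min property\<close>

locale max_min = rel_pres V H R
  for V :: "'x set" and H :: "('h, 'm) monoid_scheme" and R :: "('x, 'h) rel_expr" +
  fixes \<theta> :: "'x \<Rightarrow> int" and k l :: nat
  assumes strict: "x \<in> V \<Longrightarrow> \<theta> x \<noteq> 0"
    and adm: "height \<theta> (skeleton R) (length R) = 0"
    and k: "k \<in> {1..length R}" and l: "l \<in> {1..length R}"
    and k_max: "\<And>j. j \<in> {1..length R} - {k} \<Longrightarrow> height \<theta> (skeleton R) j < height \<theta> (skeleton R) k"
    and l_min: "\<And>j. j \<in> {1..length R} - {l} \<Longrightarrow> height \<theta> (skeleton R) j > height \<theta> (skeleton R) l"
    and k_next: "fst (R ! (k - 1)) \<noteq> fst (R ! (k mod length R))"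
    and l_next: "fst (R ! (l - 1)) \<noteq> fst (R ! (l mod length R))"
begin

abbreviation "\<phi> \<equiv> height \<theta> (skeleton R)"
abbreviation "letter i \<equiv> fst (R ! i)"
abbreviation "exponent i \<equiv> fst (snd (R ! i))"
abbreviation "coeff i \<equiv> snd (snd (R ! i))"
abbreviation "span x \<equiv> \<bar>\<theta> x\<bar>"

lemma exponent_cases: "i < length R \<Longrightarrow> exponent i = 1 \<or> exponent i = -1"
  using pres nth_mem[of i R] by (auto simp: relative_presentation_def split_beta)

lemma height_0: "\<phi> 0 = 0"
  by (simp add: height_def)

lemma height_Suc: "i < length R \<Longrightarrow> \<phi> (Suc i) = \<phi> i + exponent i * \<theta> (letter i)"
  by (simp add: height_def skeleton_def split_beta)

lemma height_step: "i < length R \<Longrightarrow> \<bar>\<phi> (Suc i) - \<phi> i\<bar> = span (letter i)"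
  using exponent_cases[of i] by (auto simp: height_Suc)

text \<open>The extremality assumptions start at index 1; index 0 is covered because admissibility
  gives it the height of the last index.\<close>

lemma height_bounds: "j \<le> length R \<Longrightarrow> \<phi> l \<le> \<phi> j \<and> \<phi> j \<le> \<phi> k"
proof (cases "j = 0")
  case True
  have "\<phi> l \<le> \<phi> (length R) \<and> \<phi> (length R) \<le> \<phi> k"
    using k_max[of "length R"] l_min[of "length R"] k by (cases "length R = k"; cases "length R = l") auto
  then show ?thesis using True adm height_0 by simp
next
  case False
  assume "j \<le> length R"
  with False show ?thesis
    using k_max[of j] l_min[of j] by (cases "j = k"; cases "j = l") auto
qed

text \<open>The edge traversed by the letter with index \<open>i\<close> when the path starts at
  height \<open>n\<close>; that letter joins \<open>\<phi> i\<close> to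
  \<open>\<phi> (Suc i)\<close>.\<close>

definition step_edge :: "int \<Rightarrow> nat \<Rightarrow> int \<times> 'x" where
  "step_edge n i = (n + min (\<phi> i) (\<phi> (Suc i)), letter i)"

definition step_word :: "int \<Rightarrow> nat \<Rightarrow> ('h + (int \<times> 'x) \<times> bool) list" where
  "step_word n i = [Inr (step_edge n i, exponent i = 1), Inl (coeff i)]"

lemma weight_take: "j \<le> length R \<Longrightarrow> weight \<theta> (relator_word (take j R)) = \<phi> j"
proof (induction j)
  case (Suc j)
  then show ?case
    using exponent_cases[of j] by (auto simp: take_Suc_conv_app_nth relator_word_def split_beta height_Suc)
qed (simp add: relator_word_def height_0)

lemma lift_take:
  "j \<le> length R \<Longrightarrow> lift \<theta> n (relator_word (take j R)) = concat (map (step_word n) [0..<j])"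
proof (induction j)
  case (Suc j)
  have "relator_word (take (Suc j) R) = relator_word (take j R) @ [Inr (letter j, exponent j = 1), Inl (coeff j)]"
    using Suc.prems by (simp add: take_Suc_conv_app_nth relator_word_def split_beta)
  moreover have "min (n + \<phi> j) (n + \<phi> j + letter_weight \<theta> (letter j, exponent j = 1)) = n + min (\<phi> j) (\<phi> (Suc j))"
    using Suc.prems exponent_cases[of j] height_Suc[of j] by auto
  ultimately show ?case
    using Suc by (simp add: lift_append weight_take step_word_def step_edge_def del: letter_weight.simps)
qed (simp add: relator_word_def)

lemma weight_relator: "weight \<theta> (relator_word R) = 0"
  using weight_take[of "length R"] adm by simp

lemma lift_relator: "lift \<theta> n (relator_word R) = concat (map (step_word n) [0..<length R])"
  using lift_take[of "length R"] by simp

lemma edges_steps: "edges (concat (map (step_word n) is)) = step_edge n ` set is"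
  by (induction "is") (auto simp: step_word_def)

lemma occurs_once_step:
  assumes "i < length R" "\<And>j. j < length R \<Longrightarrow> step_edge n j = step_edge n i \<Longrightarrow> j = i"
  shows "occurs_once (step_edge n i) (lift \<theta> n (relator_word R))"
proof -
  have "[0..<length R] = [0..<i] @ i # [Suc i..<length R]"
    using assms(1) by (metis le_add_diff_inverse less_imp_le_nat upt_add_eq_append upt_conv_Cons zero_le)
  then have "lift \<theta> n (relator_word R) = concat (map (step_word n) [0..<i]) @
      Inr (step_edge n i, exponent i = 1) # (Inl (coeff i) # concat (map (step_word n) [Suc i..<length R]))"
    unfolding lift_relator by (simp add: step_word_def)
  moreover have "step_edge n i \<notin> edges (concat (map (step_word n) [0..<i]))"
    "step_edge n i \<notin> edges (Inl (coeff i) # concat (map (step_word n) [Suc i..<length R]))"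
  proof -
    have ne: "step_edge n i \<noteq> step_edge n j" if "j < length R" "j \<noteq> i" for j
      using assms(2)[OF that(1)] that(2) by auto
    show "step_edge n i \<notin> edges (concat (map (step_word n) [0..<i]))"
      "step_edge n i \<notin> edges (Inl (coeff i) # concat (map (step_word n) [Suc i..<length R]))"
      unfolding edges_simps(2) edges_steps image_iff Bex_def
      using assms(1) ne by (metis atLeastLessThan_iff less_irrefl not_less_eq_eq order.strict_trans set_upt le_refl)+
  qed
  ultimately show ?thesis unfolding occurs_once_def by blast
qed

text \<open>Apart from the \<open>c\<close>-th letter, only its cyclic successor has an end at the height \<open>\<phi> c\<close>.\<close>

lemma extremal_step_unique:
  assumes c: "c \<in> {1..length R}" "\<And>j. j \<in> {1..length R} - {c} \<Longrightarrow> \<phi> j \<noteq> \<phi> c"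
    and next_c: "letter (c - 1) \<noteq> letter (c mod length R)"
    and i: "i < length R" "letter i = letter (c - 1)" "\<phi> i = \<phi> c \<or> \<phi> (Suc i) = \<phi> c"
  shows "i = c - 1"
proof (rule ccontr)
  assume ne: "i \<noteq> c - 1"
  then have "Suc i \<noteq> c" by auto
  then have "\<phi> (Suc i) \<noteq> \<phi> c" using c(2)[of "Suc i"] i(1) by auto
  then have eq: "\<phi> i = \<phi> c" using i(3) by simp
  \<comment> \<open>Index 0 has the height of index \<open>length R\<close>, so \<open>i = 0\<close>
    occurs only for \<open>c = length R\<close>; this is the cyclic wrap-around.\<close>
  have "i = c mod length R"
  proof (cases "i = 0")
    case True
    then have "\<phi> (length R) = \<phi> c" using eq adm height_0 by simp
    then have "length R = c" using c(2)[of "length R"] i(1) by auto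
    then show ?thesis using True by simp
  next
    case False
    then have "i = c" using c(2)[of i] i(1) eq by auto
    then show ?thesis using i(1) by simp
  qed
  then show False using next_c i(2) by simp
qed

text \<open>Starting at \<open>- \<phi> l\<close> puts the lowest vertex of the path at 0 and the
  highest at \<open>depth\<close>.\<close>

definition base_relator :: "('h + (int \<times> 'x) \<times> bool) list" where
  "base_relator = lift \<theta> (- \<phi> l) (relator_word R)"

abbreviation "depth \<equiv> \<phi> k - \<phi> l"

lemma lift_eq_translate: "lift \<theta> n (relator_word R) = translate (n + \<phi> l) base_relator"
  using lift_translate[of \<theta> "- \<phi> l" "n + \<phi> l" "relator_word R"] by (simp add: base_relator_def)

lemma coeffs_base: "coeffs base_relator \<subseteq> carrier H"
  by (simp add: base_relator_def coeffs_relator_word)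

lemma edges_base:
  "edges base_relator \<subseteq> {(m, x). x \<in> fst ` set R \<and> 0 \<le> m \<and> m + span x \<le> depth}"
proof -
  have "step_edge (- \<phi> l) i \<in> {(m, x). x \<in> fst ` set R \<and> 0 \<le> m \<and> m + span x \<le> depth}"
    if "i < length R" for i
    using height_bounds[of i] height_bounds[of "Suc i"] height_step[of i] that by (auto simp: step_edge_def)
  then show ?thesis
    unfolding base_relator_def lift_relator edges_steps by (intro image_subsetI) simp
qed

lemma top_once: "occurs_once (depth - span (letter (k - 1)), letter (k - 1)) base_relator"
proof -
  have i: "k - 1 < length R" "Suc (k - 1) = k" using k by auto
  have "step_edge (- \<phi> l) (k - 1) = (depth - span (letter (k - 1)), letter (k - 1))"
    using height_bounds[of "k - 1"] height_step[OF i(1)] i by (auto simp: step_edge_def)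
  moreover have "occurs_once (step_edge (- \<phi> l) (k - 1)) base_relator"
    unfolding base_relator_def
  proof (rule occurs_once_step[OF i(1)])
    fix j assume j: "j < length R" "step_edge (- \<phi> l) j = step_edge (- \<phi> l) (k - 1)"
    have x: "letter j = letter (k - 1)" "min (\<phi> j) (\<phi> (Suc j)) = min (\<phi> (k - 1)) (\<phi> k)"
      using j(2) i(2) by (auto simp: step_edge_def)
    \<comment> \<open>Equal letters have equal spans, so equal lower ends force equal upper ends,
      and the upper end of the step into \<open>k\<close> is the maximum.\<close>
    have "\<phi> j = \<phi> k \<or> \<phi> (Suc j) = \<phi> k"
      using x height_step[OF j(1)] height_step[OF i(1)] height_bounds[of "k - 1"] i
      by (auto simp: min_def abs_if split: if_splits)
    then show "j = k - 1"
      using extremal_step_unique[OF k _ k_next j(1) x(1)] k_max by fastforce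
  qed
  ultimately show ?thesis by simp
qed

lemma bottom_once: "occurs_once (0, letter (l - 1)) base_relator"
proof -
  have i: "l - 1 < length R" "Suc (l - 1) = l" using l by auto
  have "step_edge (- \<phi> l) (l - 1) = (0, letter (l - 1))"
    using height_bounds[of "l - 1"] i by (auto simp: step_edge_def)
  moreover have "occurs_once (step_edge (- \<phi> l) (l - 1)) base_relator"
    unfolding base_relator_def
  proof (rule occurs_once_step[OF i(1)])
    fix j assume j: "j < length R" "step_edge (- \<phi> l) j = step_edge (- \<phi> l) (l - 1)"
    have x: "letter j = letter (l - 1)" "min (\<phi> j) (\<phi> (Suc j)) = min (\<phi> (l - 1)) (\<phi> l)"
      using j(2) i(2) by (auto simp: step_edge_def)
    have "\<phi> j = \<phi> l \<or> \<phi> (Suc j) = \<phi> l"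
      using x height_bounds[of "l - 1"] i by (auto simp: min_def split: if_splits)
    then show "j = l - 1"
      using extremal_step_unique[OF l _ l_next j(1) x(1)] l_min by fastforce
  qed
  ultimately show ?thesis by simp
qed

lemma letters_in_V: "fst ` set R \<subseteq> V"
  using pres by (auto simp: relative_presentation_def)

text \<open>\<open>X\<close> is left open between the letters of the relator and all of
  \<open>V\<close>, so that it can be chosen finite.\<close>

lemma band_base:
  assumes "group P" "\<rho> \<in> hom H P" "fst ` set R \<subseteq> X" "X \<subseteq> V" "depth \<le> L"
    and "\<And>x. x \<in> X \<Longrightarrow> span x \<le> L"
  shows "band H P \<rho> X span L depth (letter (k - 1)) (letter (l - 1)) base_relator"
  by (rule band.intro)
    (use assms group_H coeffs_base edges_base top_once bottom_once strict in auto)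

lemma natural_hom_word:
  "h \<in> carrier H \<Longrightarrow> word_value G (natural_hom V H R) (rel_gen V H R) [Inl h] = natural_hom V H R h"
  using interpD(5)[OF interp_G] by simp

text \<open>The relator has weight 0 and its lifts from all heights are translates of
  \<open>base_relator\<close>; hence it is trivial in the wreath product.\<close>

lemma wreath_hom:
  assumes "interp H P \<rho> q" "\<And>m x. q (m + N, x) = q (m, x)"
    and "\<And>n. word_value P \<rho> q (translate n base_relator) = \<one>\<^bsub>P\<^esub>"
  obtains \<Phi> where "\<Phi> \<in> hom G (wreath N P)"
    "\<And>w. coeffs w \<subseteq> carrier H \<Longrightarrow> edges w \<subseteq> V \<Longrightarrow>
      \<Phi> (word_value G (natural_hom V H R) (rel_gen V H R) w)
        = (weight \<theta> w mod N, \<lambda>m. word_value P \<rho> q (lift \<theta> m w))"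
proof -
  note W = word_value_wreath[OF interpD(2)[OF assms(1)] assms(1,2), where \<theta> = \<theta>]
  have "word_value (wreath N P) (\<lambda>h. (0, \<lambda>m. \<rho> h)) (\<lambda>x. (\<theta> x mod N, \<lambda>m. q (min m (m + \<theta> x), x))) (relator_word R)
      = \<one>\<^bsub>wreath N P\<^esub>"
    using assms(3) by (simp add: W(2)[OF coeffs_relator_word] weight_relator lift_eq_translate)
  from rel_group_hom[OF W(1) this] obtain \<Phi> where \<Phi>: "\<Phi> \<in> hom G (wreath N P)"
    "\<And>w. coeffs w \<subseteq> carrier H \<Longrightarrow> edges w \<subseteq> V \<Longrightarrow> \<Phi> (word_value G (natural_hom V H R) (rel_gen V H R) w)
      = word_value (wreath N P) (\<lambda>h. (0, \<lambda>m. \<rho> h)) (\<lambda>x. (\<theta> x mod N, \<lambda>m. q (min m (m + \<theta> x), x))) w"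
    by blast
  show thesis by (rule that[OF \<Phi>(1)]) (simp add: \<Phi>(2) W(2))
qed

text \<open>With \<open>P = H\<close> and identical coefficients, the image of \<open>h\<close> is
  the constant function \<open>h\<close>, from which \<open>h\<close> is read off. \<open>H\<close>
  may be infinite, so the period may be 0 and the wreath product unrestricted.\<close>

lemma natural_hom_inj: "inj_on (natural_hom V H R) (carrier H)"
proof -
  have id_hom: "(\<lambda>h. h) \<in> hom H H" by (simp add: hom_def)
  \<comment> \<open>This permits the smallest window, \<open>L = depth\<close>, which contains the
    translate by 0 only. One solved edge then already gives a state.\<close>
  have span_depth: "span x \<le> depth" if x: "x \<in> fst ` set R" for x
  proof -
    obtain i where "i < length R" "x = letter i" using x by (auto simp: in_set_conv_nth)
    then show ?thesis
      using height_step[of i] height_bounds[of i] height_bounds[of "Suc i"] by auto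
  qed
  interpret H: group H by (rule group_H)
  interpret band H H "\<lambda>h. h" "fst ` set R" span depth depth "letter (k - 1)" "letter (l - 1)" base_relator
    by (rule band_base) (use group_H id_hom letters_in_V span_depth in auto)
  let ?top = "(depth - span (letter (k - 1)), letter (k - 1))"
  have "interp H H (\<lambda>h. h) (\<lambda>_ :: int \<times> 'x. \<one>\<^bsub>H\<^esub>)" by (rule interpI) auto
  from occurs_once_solvable[OF this top_once coeffs_W]
  obtain v where v: "v \<in> carrier H"
    "word_value H (\<lambda>h. h) ((\<lambda>_. \<one>\<^bsub>H\<^esub>)(?top := v)) base_relator = \<one>\<^bsub>H\<^esub>" by blast
  define f where "f = (\<lambda>_ :: int \<times> 'x. \<one>\<^bsub>H\<^esub>)(?top := v)"
  have "?top \<in> window" using y_in_V span_le by (simp add: window_def)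
  moreover have "word_value H (\<lambda>h. h) f (translate 0 base_relator) = \<one>\<^bsub>H\<^esub>"
  proof -
    have "(\<lambda>(m, x). f (m + 0, x)) = f" by auto
    then show ?thesis using v(2) unfolding word_value_translate f_def by (simp only:)
  qed
  ultimately have "state f"
    unfolding state_def using v(1) by (auto simp: f_def)
  from state_extends[OF this] obtain q N where q: "\<And>e. q e \<in> carrier H"
    "\<And>n. word_value H (\<lambda>h. h) q (translate n base_relator) = \<one>\<^bsub>H\<^esub>" "\<And>m x. q (m + N, x) = q (m, x)"
    by metis
  have "interp H H (\<lambda>h. h) q" by (rule interpI) (use q(1) in auto)
  from wreath_hom[OF this q(3,2)] obtain \<Phi> where \<Phi>:
    "\<And>w. coeffs w \<subseteq> carrier H \<Longrightarrow> edges w \<subseteq> V \<Longrightarrow>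
      \<Phi> (word_value G (natural_hom V H R) (rel_gen V H R) w)
        = (weight \<theta> w mod N, \<lambda>m. word_value H (\<lambda>h. h) q (lift \<theta> m w))" by blast
  have "\<Phi> (natural_hom V H R h) = (0, \<lambda>m. h)" if "h \<in> carrier H" for h
    using \<Phi>[of "[Inl h]", unfolded natural_hom_word[OF that]] that by simp
  then show ?thesis by (intro inj_onI) (metis prod.inject)
qed

text \<open>Nonzero weight survives in a finite cyclic group. Otherwise a finite labelling of a
  large window detects the word, and a periodic extension of it gives a finite wreath
  product.\<close>

lemma residually_finite_rel_group:
  assumes "residually_finite H"
  shows "residually_finite G"
proof (rule residually_finiteI[OF G.is_group])
  fix g assume g: "g \<in> carrier G" "g \<noteq> \<one>\<^bsub>G\<^esub>"
  obtain w where w: "coeffs w \<subseteq> carrier H" "edges w \<subseteq> V"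
    "word_value G (natural_hom V H R) (rel_gen V H R) w = g"
    using ex_word_G[OF g(1)] by blast
  show "\<exists>(P :: (int \<times> (int \<Rightarrow> nat \<times> 'h set \<Rightarrow> nat \<times> 'h set)) monoid) \<Phi>.
      group P \<and> finite (carrier P) \<and> \<Phi> \<in> hom G P \<and> \<Phi> g \<noteq> \<one>\<^bsub>P\<^esub>"
  proof (cases "weight \<theta> w = 0")
    case False
    \<comment> \<open>Over the trivial group the wreath product is cyclic; permutations of the empty
      set supply it in the type fixed above. The order exceeds the absolute weight, so the weight is
      not divisible by it.\<close>
    define P where "P = perm_group ({} :: (nat \<times> 'h set) set)"
    have P: "group P" "finite (carrier P)" unfolding P_def by (simp_all add: group_perm_group finite_perm_group)
    have i: "interp H P (\<lambda>_. \<one>\<^bsub>P\<^esub>) (\<lambda>_ :: int \<times> 'x. \<one>\<^bsub>P\<^esub>)"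
      unfolding interp_def using group_H P(1) by (auto simp: hom_def group.is_monoid monoid.r_one)
    have trivial: "x = \<one>\<^bsub>P\<^esub>" if "x \<in> carrier P" for x using that by (simp add: P_def)
    have rel: "word_value P (\<lambda>_. \<one>\<^bsub>P\<^esub>) (\<lambda>_. \<one>\<^bsub>P\<^esub>) (translate n base_relator) = \<one>\<^bsub>P\<^esub>" for n
      by (rule trivial, rule word_value_closed[OF i]) (simp add: coeffs_base)
    obtain \<Phi> where \<Phi>: "\<Phi> \<in> hom G (wreath (\<bar>weight \<theta> w\<bar> + 1) P)"
      "fst (\<Phi> g) = weight \<theta> w mod (\<bar>weight \<theta> w\<bar> + 1)"
      by (rule wreath_hom[OF i _ rel, of "\<bar>weight \<theta> w\<bar> + 1"]) (use w in auto)
    have "weight \<theta> w mod (\<bar>weight \<theta> w\<bar> + 1) \<noteq> 0"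
      using False dvd_imp_le_int[of "weight \<theta> w" "\<bar>weight \<theta> w\<bar> + 1"] by (auto simp: mod_eq_0_iff_dvd)
    then have "\<Phi> g \<noteq> \<one>\<^bsub>wreath (\<bar>weight \<theta> w\<bar> + 1) P\<^esub>" using \<Phi>(2) by auto
    then show ?thesis using \<Phi>(1) group_wreath[OF P(1)] finite_wreath[OF P(1) _ P(2)]
      by (intro exI[of _ "wreath (\<bar>weight \<theta> w\<bar> + 1) P"] exI[of _ \<Phi>]) auto
  next
    case True
    let ?nat = "natural_hom V H R" and ?gen = "rel_gen V H R"
    let ?y = "letter (k - 1)"
    \<comment> \<open>A finite substitute for \<open>V\<close>, large enough for the relator and for
      \<open>w\<close>.\<close>
    define X where "X = fst ` set R \<union> edges w"
    have X: "finite X" "X \<subseteq> V" "fst ` set R \<subseteq> X"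
      using w(2) letters_in_V by (auto simp: X_def finite_edges)
    \<comment> \<open>A bound for the lower ends of the lifted word; starting at \<open>C\<close>
      instead of 0 makes them nonnegative.\<close>
    define C where "C = (\<Sum>(m, x)\<in>edges (lift \<theta> 0 w). \<bar>m\<bar>)"
    have C: "\<bar>m\<bar> \<le> C" if "(m, x) \<in> edges (lift \<theta> 0 w)" for m x
      unfolding C_def using member_le_sum[OF that, of "\<lambda>(m, x). \<bar>m\<bar>"] by (auto simp: finite_edges)
    have "0 \<le> C" unfolding C_def by (rule sum_nonneg) auto
    define S where "S = (\<Sum>x\<in>X. span x)"
    have S: "span x \<le> S" if "x \<in> X" for x
      unfolding S_def using member_le_sum[OF that, of span] X(1) by auto
    have "0 \<le> S" unfolding S_def by (rule sum_nonneg) auto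
    \<comment> \<open>Lower ends of the shifted word are at most \<open>2 * C\<close> and spans at
      most \<open>S\<close>; the summand \<open>\<bar>depth\<bar>\<close> makes room for a
      relator.\<close>
    define L where "L = \<bar>depth\<bar> + 2 * C + S"
    have L: "depth \<le> L" "span x \<le> L" if "x \<in> X" for x
      using S[OF that] \<open>0 \<le> C\<close> \<open>0 \<le> S\<close> by (auto simp: L_def)
    have dL: "depth \<le> L" using \<open>0 \<le> C\<close> \<open>0 \<le> S\<close> by (auto simp: L_def)
    define u where "u = lift \<theta> C w"
    have cu: "coeffs u \<subseteq> carrier H" using w(1) by (simp add: u_def)
    have eu: "x \<in> X \<and> 0 \<le> m \<and> m + span x \<le> L" if "(m, x) \<in> edges u" for m x
    proof -
      have "u = translate C (lift \<theta> 0 w)" using lift_translate[of \<theta> 0 C w] by (simp add: u_def)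
      with that obtain m' where m': "(m', x) \<in> edges (lift \<theta> 0 w)" "m = m' + C" by auto
      moreover have "x \<in> X" using edges_lift[OF m'(1)] by (simp add: X_def)
      ultimately show ?thesis using C[OF m'(1)] S[of x] by (auto simp: L_def)
    qed
    let ?r = "\<lambda>i. translate (int i) base_relator"
    \<comment> \<open>The presented group labels every edge by its generator. This satisfies all
      relators and keeps the lifted word nontrivial, as \<open>word_detected\<close>
      requires.\<close>
    let ?q = "\<lambda>(m :: int, x). ?gen x"
    have iG: "interp H G ?nat ?q"
      using interp_G by (auto simp: interp_def)
    have val_u: "word_value G ?nat ?q u \<noteq> \<one>\<^bsub>G\<^esub>"
      unfolding u_def word_value_lift using w(3) g(2) by simp
    have val_r: "word_value G ?nat ?q (?r i) = \<one>\<^bsub>G\<^esub>" for i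
      using word_value_lift[of G ?nat ?gen \<theta> "int i - \<phi> l" "relator_word R"] relator_word_trivial
      by (simp add: lift_eq_translate)
    have once: "occurs_once (int i + depth - span ?y, ?y) (?r i)" for i
      using occurs_once_map_edges[OF _ top_once, of "\<lambda>(m, x). (m + int i, x)"]
      by (simp add: inj_def algebra_simps)
    \<comment> \<open>The edge ends at height \<open>i + depth\<close>, above everything in the
      translate by a smaller \<open>j\<close>: the system is triangular.\<close>
    have late: "(int i + depth - span ?y, ?y) \<notin> edges (?r j)" if "j < i" for i j
      using edges_base that by auto
    \<comment> \<open>The indices up to \<open>L - depth\<close> are precisely the translates inside
      the window.\<close>
    have "\<exists>(P :: (nat \<times> 'h set \<Rightarrow> nat \<times> 'h set) monoid) \<rho> p.
      interp H P \<rho> p \<and> finite (carrier P) \<and> word_value P \<rho> p u \<noteq> \<one>\<^bsub>P\<^esub>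
      \<and> (\<forall>i<Suc (nat (L - depth)). word_value P \<rho> p (?r i) = \<one>\<^bsub>P\<^esub>)"
      by (rule word_detected[OF group_H assms cu iG val_u, where e = "\<lambda>i. (int i + depth - span ?y, ?y)"])
        (use coeffs_base val_r once late in auto)
    then obtain P :: "(nat \<times> 'h set \<Rightarrow> nat \<times> 'h set) monoid" and \<rho> p where
      P: "interp H P \<rho> p" "finite (carrier P)" "word_value P \<rho> p u \<noteq> \<one>\<^bsub>P\<^esub>"
      "\<And>i. i < Suc (nat (L - depth)) \<Longrightarrow> word_value P \<rho> p (?r i) = \<one>\<^bsub>P\<^esub>"
      by blast
    interpret P: group P using P(1) by (rule interpD)
    interpret band H P \<rho> X span L depth ?y "letter (l - 1)" base_relator
      by (rule band_base) (use P.is_group interpD(3)[OF P(1)] X dL L in auto)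
    \<comment> \<open>Cutting \<open>p\<close> off outside the window gives the default values of a
      state; relators and the lifted word inside the window keep their values.\<close>
    define f where "f e = (if e \<in> window then p e else \<one>\<^bsub>P\<^esub>)" for e
    have "word_value P \<rho> f (translate n base_relator) = \<one>\<^bsub>P\<^esub>" if "0 \<le> n" "n + depth \<le> L" for n
    proof -
      have "word_value P \<rho> f (translate n base_relator) = word_value P \<rho> p (?r (nat n))"
      proof -
        have "f e = p e" if "e \<in> edges (translate n base_relator)" for e
          using edges_translate[of "fst e" "snd e" n] that \<open>0 \<le> n\<close> \<open>n + depth \<le> L\<close>
          by (cases e) (auto simp: f_def window_def simp del: edges_map_edges)
        then show ?thesis using \<open>0 \<le> n\<close> by (auto intro!: word_value_cong simp del: edges_map_edges)
      qed
      then show ?thesis using P(4)[of "nat n"] that by simp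
    qed
    then have "state f"
      unfolding state_def using interpD(4)[OF P(1)] by (auto simp: f_def)
    then show ?thesis
    proof (rule state_extends)
      fix q N assume q: "\<And>e. q e \<in> carrier P" "\<And>e. e \<in> window \<Longrightarrow> q e = f e"
        "\<And>n. word_value P \<rho> q (translate n base_relator) = \<one>\<^bsub>P\<^esub>"
        "\<And>m x. q (m + N, x) = q (m, x)" and N: "finite X \<Longrightarrow> finite (carrier P) \<Longrightarrow> 0 < N"
      have "interp H P \<rho> q" by (rule interpI) (use q(1) in auto)
      from wreath_hom[OF this q(4,3)] obtain \<Phi> where \<Phi>: "\<Phi> \<in> hom G (wreath N P)"
        "\<And>w. coeffs w \<subseteq> carrier H \<Longrightarrow> edges w \<subseteq> V \<Longrightarrow>
          \<Phi> (word_value G ?nat ?gen w) = (weight \<theta> w mod N, \<lambda>m. word_value P \<rho> q (lift \<theta> m w))" by blast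
      have "word_value P \<rho> q u = word_value P \<rho> p u"
        by (rule word_value_cong) (use eu q(2) in \<open>auto simp: f_def window_def\<close>)
      \<comment> \<open>The coordinate at height \<open>C\<close> is the value of \<open>u\<close>,
        the lift of \<open>w\<close> from \<open>C\<close>.\<close>
      then have "snd (\<Phi> g) C \<noteq> \<one>\<^bsub>P\<^esub>"
        using \<Phi>(2)[OF w(1,2)] P(3) by (simp add: w(3) u_def)
      then have "\<Phi> g \<noteq> \<one>\<^bsub>wreath N P\<^esub>" by auto
      then show ?thesis
        using \<Phi>(1) group_wreath[OF P.is_group] finite_wreath[OF P.is_group N[OF X(1) P(2)] P(2)]
        by (intro exI[of _ "wreath N P"] exI[of _ \<Phi>]) auto
    qed
  qed
qed

end

theorem theorem1:
  fixes V :: "'x set" and H :: "('h, 'm) monoid_scheme" and R :: "('x, 'h) rel_expr"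
  assumes "relative_presentation V H R"
    and "unique_max_min V (skeleton R)"
  shows "inj_on (natural_hom V H R) (carrier H) \<and>
    (residually_finite (rel_group V H R) \<longleftrightarrow> residually_finite H)"
proof -
  have len: "length (skeleton R) = length R" by (simp add: skeleton_def)
  have nth: "fst (skeleton R ! i) = fst (R ! i)" if "i < length R" for i
    using that by (simp add: skeleton_def split_beta)
  obtain \<theta> k l where *: "strict_weight_function V \<theta>" "admissible \<theta> (skeleton R)"
    "k \<in> {1..length R}" "l \<in> {1..length R}"
    "\<forall>j\<in>{1..length R} - {k}. height \<theta> (skeleton R) j < height \<theta> (skeleton R) k"
    "\<forall>j\<in>{1..length R} - {l}. height \<theta> (skeleton R) j > height \<theta> (skeleton R) l"
    "fst (skeleton R ! (k - 1)) \<noteq> fst (skeleton R ! (k mod length R))"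
    "fst (skeleton R ! (l - 1)) \<noteq> fst (skeleton R ! (l mod length R))"
    using assms(2) unfolding unique_max_min_def len by blast
  interpret max_min V H R \<theta> k l
  proof
    have "0 < length R" using *(3) by auto
    then have "k mod length R < length R" "l mod length R < length R" by simp_all
    then show "fst (R ! (k - 1)) \<noteq> fst (R ! (k mod length R))" "fst (R ! (l - 1)) \<noteq> fst (R ! (l mod length R))"
      using *(3,4,7,8) by (auto simp: nth)
  qed (use assms(1) * in \<open>auto simp: strict_weight_function_def admissible_def len\<close>)
  \<comment> \<open>That \<open>H\<close> inherits residual finiteness follows from the embedding
    just obtained in the first part.\<close>
  show ?thesis
    using natural_hom_inj residually_finite_rel_group
      residually_finite_inj_hom[OF G.is_group group_H natural_hom_hom natural_hom_inj] by blast
qed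

end
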